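(* Let $t\geq 1$ be an integer and let $H$ be an ordered bipartite graph with maximum degree at most $t$ in one side of the bipartition (that is, in at least one of its two parts, every vertex has degree at most $t$). Then $\operatorname{ex}_<(n,H)\leq n^{2-1/t+o(1)}$ as $n\to\infty$ (with $t$ and $H$ fixed); that is, for every $\varepsilon>0$ there exists $n_0$ such that $\operatorname{ex}_<(n,H)\leq n^{2-1/t+\varepsilon}$ for all $n\geq n_0$.
   Context: An ordered graph is a pair $(G,<)$ where $G$ is a (finite simple) graph and $<$ is a total ordering of its vertex set; it is often written simply as $G$. An ordered graph $(G,<)$ contains $(H,<')$ as an ordered subgraph if there exists an order-preserving embedding of $H$ into $G$, i.e. an injective map $V(H)\to V(G)$ that preserves the vertex order and maps edges of $H$ to edges of $G$. The extremal number $\operatorname{ex}_<(n,H)$ of an ordered graph $H$ is the maximum possible number of edges in an ordered graph on $n$ vertices that does not contain $H$ as an ordered subgraph. The interval chromatic number $\chi_<(H)$ of an ordered graph $H$ is the minimum number of colours needed to colour the vertices of $H$ such that there are no edges within the colour classes and each colour class is an interval with respect to the ordering on $V(H)$. An ordered graph $H$ is called ordered bipartite if $\chi_<(H)=2$; thus its vertex set splits into two parts $X,Y$ (the sides of the bipartition), each containing no edges, with every vertex of $X$ preceding every vertex of $Y$ in the ordering. *)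

theory Defs
  imports Complex_Main
begin

text \<open>
  The field \<open>ord\<close> holds the strict total order of the vertex set: \<open>(x, y) \<in> ord G\<close> means
  that \<open>x\<close> precedes \<open>y\<close>.
\<close>
record 'a ograph =
  verts :: "'a set"
  edges :: "'a set set"
  ord :: "('a \<times> 'a) set"

definition ordered_graph :: "'a ograph \<Rightarrow> bool" where
  "ordered_graph G \<longleftrightarrow>
     finite (verts G) \<and>
     (\<forall>e\<in>edges G. e \<subseteq> verts G \<and> card e = 2) \<and>
     ord G \<subseteq> verts G \<times> verts G \<and>
     strict_linear_order_on (verts G) (ord G)"

definition degree :: "'a ograph \<Rightarrow> 'a \<Rightarrow> nat" where
  "degree G v = card {e \<in> edges G. v \<in> e}"

definition contains_ordered :: "'b ograph \<Rightarrow> 'a ograph \<Rightarrow> bool" where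
  "contains_ordered G H \<longleftrightarrow>
     (\<exists>f. inj_on f (verts H) \<and> f ` verts H \<subseteq> verts G \<and>
          (\<forall>(x, y) \<in> ord H. (f x, f y) \<in> ord G) \<and>
          (\<forall>e\<in>edges H. f ` e \<in> edges G))"

text \<open>
  Every finite ordered graph is isomorphic to one whose vertices are natural numbers, so
  ranging over host graphs on type \<^typ>\<open>nat\<close> loses nothing (lemma \<open>card_edges_le_ex_ord\<close>). The
  maximum is taken over a finite set, which is nonempty as soon as \<open>H\<close> has an edge, in
  particular for ordered bipartite \<open>H\<close>.
\<close>
definition ex_ord :: "nat \<Rightarrow> 'a ograph \<Rightarrow> nat" where
  "ex_ord n H =
     Max {card (edges G) | G :: nat ograph.
            ordered_graph G \<and> card (verts G) = n \<and> \<not> contains_ordered G H}"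

definition order_interval :: "'a ograph \<Rightarrow> 'a set \<Rightarrow> bool" where
  "order_interval G S \<longleftrightarrow> S \<subseteq> verts G \<and>
     (\<forall>x\<in>S. \<forall>y\<in>S. \<forall>z\<in>verts G. (x, z) \<in> ord G \<and> (z, y) \<in> ord G \<longrightarrow> z \<in> S)"

definition interval_colouring :: "'a ograph \<Rightarrow> nat \<Rightarrow> ('a \<Rightarrow> nat) \<Rightarrow> bool" where
  "interval_colouring G k c \<longleftrightarrow>
     c ` verts G \<subseteq> {..<k} \<and>
     (\<forall>i<k. order_interval G {v \<in> verts G. c v = i} \<and>
            (\<forall>e\<in>edges G. \<not> e \<subseteq> {v \<in> verts G. c v = i}))"

definition interval_chromatic_number :: "'a ograph \<Rightarrow> nat" where
  "interval_chromatic_number G = (LEAST k. \<exists>c. interval_colouring G k c)"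

definition ordered_bipartite :: "'a ograph \<Rightarrow> bool" where
  "ordered_bipartite G \<longleftrightarrow> ordered_graph G \<and> interval_chromatic_number G = 2"

text \<open>
  If \<open>G\<close> has isolated vertices, its ordered bipartition need not be unique.
\<close>
definition ordered_bipartition :: "'a ograph \<Rightarrow> 'a set \<Rightarrow> 'a set \<Rightarrow> bool" where
  "ordered_bipartition G X Y \<longleftrightarrow>
     X \<union> Y = verts G \<and> X \<inter> Y = {} \<and>
     (\<forall>e\<in>edges G. \<not> e \<subseteq> X \<and> \<not> e \<subseteq> Y) \<and>
     (\<forall>x\<in>X. \<forall>y\<in>Y. (x, y) \<in> ord G)"

lemma finite_ex_ord_set:
  "finite {card (edges G) | G :: 'b ograph. ordered_graph G \<and> card (verts G) = n \<and> P G}"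
proof (rule finite_subset)
  show "{card (edges G) | G :: 'b ograph. ordered_graph G \<and> card (verts G) = n \<and> P G} \<subseteq> {..2 ^ n}"
  proof safe
    fix G :: "'b ograph"
    assume G: "ordered_graph G"
    then have "edges G \<subseteq> Pow (verts G)" and fin: "finite (verts G)"
      by (auto simp: ordered_graph_def)
    then have "card (edges G) \<le> card (Pow (verts G))"
      by (intro card_mono) auto
    then show "card (edges G) \<le> 2 ^ card (verts G)"
      using fin by (simp add: card_Pow)
  qed
qed simp

lemma card_edges_le_ex_ord:
  fixes G :: "'b ograph"
  assumes G: "ordered_graph G" and n: "card (verts G) = n" and free: "\<not> contains_ordered G H"
  shows "card (edges G) \<le> ex_ord n H"
proof -
  have fin: "finite (verts G)"
    using G by (simp add: ordered_graph_def)
  then obtain g :: "'b \<Rightarrow> nat" where g: "inj_on g (verts G)"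
    using finite_imp_inj_to_nat_seg by metis
  define G' where "G' = \<lparr>verts = g ` verts G, edges = (`) g ` edges G,
    ord = map_prod g g ` ord G\<rparr>"
  have sub: "\<And>e. e \<in> edges G \<Longrightarrow> e \<subseteq> verts G"
    and ordsub: "\<And>x y. (x, y) \<in> ord G \<Longrightarrow> x \<in> verts G \<and> y \<in> verts G"
    using G by (auto simp: ordered_graph_def)
  have lin: "trans (ord G)" "irrefl (ord G)" "total_on (verts G) (ord G)"
    using G by (auto simp: ordered_graph_def strict_linear_order_on_def)
  have "trans (ord G')"
  proof (rule transI)
    fix x y z assume "(x, y) \<in> ord G'" "(y, z) \<in> ord G'"
    then obtain a b b' c where *: "(a, b) \<in> ord G" "(b', c) \<in> ord G" "x = g a" "y = g b" "y = g b'" "z = g c"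
      by (auto simp: G'_def)
    then have "b = b'" using g ordsub by (metis inj_onD)
    then have "(a, c) \<in> ord G" using * lin(1) by (metis transD)
    then show "(x, z) \<in> ord G'" using * by (force simp: G'_def)
  qed
  moreover have "irrefl (ord G')"
  proof (rule irreflI)
    fix x show "(x, x) \<notin> ord G'"
    proof
      assume "(x, x) \<in> ord G'"
      then obtain a b where *: "(a, b) \<in> ord G" "x = g a" "x = g b" by (auto simp: G'_def)
      then have "a = b" using g ordsub by (metis inj_onD)
      then show False using * lin(2) by (auto simp: irrefl_def)
    qed
  qed
  moreover have "total_on (verts G') (ord G')"
    using lin(3) by (force simp: G'_def total_on_def)
  moreover have "card (g ` e) = 2" if "e \<in> edges G" for e
    using that G sub g by (metis card_image inj_on_subset ordered_graph_def)
  ultimately have og: "ordered_graph G'"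
    using fin sub ordsub
    by (fastforce simp: ordered_graph_def strict_linear_order_on_def G'_def)
  have cV: "card (verts G') = n"
    using g n by (simp add: G'_def card_image)
  have "inj_on ((`) g) (edges G)"
    using g sub by (meson PowI inj_on_image_Pow inj_on_subset subsetI)
  then have cE: "card (edges G') = card (edges G)"
    by (simp add: G'_def card_image)
  define h where "h = the_inv_into (verts G) g"
  have h: "\<And>x. x \<in> verts G \<Longrightarrow> h (g x) = x"
    using g by (simp add: h_def the_inv_into_f_f)
  have "\<not> contains_ordered G' H"
  proof
    assume "contains_ordered G' H"
    then obtain f where f: "inj_on f (verts H)" "f ` verts H \<subseteq> verts G'"
      "\<And>x y. (x, y) \<in> ord H \<Longrightarrow> (f x, f y) \<in> ord G'" "\<And>e. e \<in> edges H \<Longrightarrow> f ` e \<in> edges G'"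
      unfolding contains_ordered_def by blast
    have "inj_on (h \<circ> f) (verts H)"
    proof (rule comp_inj_on[OF f(1)])
      have "inj_on h (verts G')" by (auto simp: inj_on_def G'_def h)
      then show "inj_on h (f ` verts H)" using f(2) by (rule inj_on_subset)
    qed
    moreover have "(h \<circ> f) ` verts H \<subseteq> verts G"
      using f(2) by (force simp: G'_def h)
    moreover have "((h \<circ> f) x, (h \<circ> f) y) \<in> ord G" if xy: "(x, y) \<in> ord H" for x y
    proof -
      obtain a b where "(a, b) \<in> ord G" "f x = g a" "f y = g b"
        using f(3)[OF xy] by (auto simp: G'_def)
      then show ?thesis using ordsub[of a b] by (simp add: h)
    qed
    moreover have "(h \<circ> f) ` e \<in> edges G" if e: "e \<in> edges H" for e
    proof -
      obtain d where d: "d \<in> edges G" "f ` e = g ` d"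
        using f(4)[OF e] by (auto simp: G'_def)
      have "(h \<circ> f) ` e = h ` g ` d" by (metis d(2) image_comp)
      also have "\<dots> = d" using sub[OF d(1)] h by (force simp: image_image)
      finally show ?thesis using d(1) by simp
    qed
    ultimately have "contains_ordered G H"
      unfolding contains_ordered_def by blast
    then show False using free by simp
  qed
  then have "card (edges G) \<in> {card (edges G) | G :: nat ograph.
      ordered_graph G \<and> card (verts G) = n \<and> \<not> contains_ordered G H}"
    using og cV cE by (auto intro!: exI[of _ G'])
  then show ?thesis
    unfolding ex_ord_def using finite_ex_ord_set by (intro Max_ge)
qed

end

theory Submission
  imports Defs "HOL-Library.Infinite_Set" "HOL-Real_Asymp.Real_Asymp"
begin

text \<open>
  Call the vertices of the side with degrees at most \<open>t\<close> rows and the other ones columns. It suffices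
  to find, in a dense 0-1 matrix, a large set \<open>W\<close> of columns and row sets \<open>J\<^sub>0 < J\<^sub>1 < \<dots>\<close> such that every
  \<open>t\<close>-subset of \<open>W\<close> has a common neighbour in every \<open>J\<^sub>i\<close>. For \<open>t \<ge> 2\<close> this is done by dependent random
  choice inside an interval \<open>I\<close> of rows. For a \<open>t\<close>-set \<open>T\<close> of columns let \<open>d\<^sub>I(T)\<close> be the number of
  common neighbours of \<open>T\<close> in \<open>I\<close>, and choose \<open>I\<close> to maximise \<open>(\<Sum>T. d\<^sub>I(T)\<^sup>t) / \<bar>I\<bar>\<^bsup>1+\<kappa>\<^esup>\<close>. Cut \<open>I\<close> into
  nested blocks whose lengths \<open>b\<^sub>0 > b\<^sub>1 > \<dots>\<close> drop faster and faster. Let \<open>p\<close> be a common neighbour of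
  \<open>T\<close>; it is bad at scale \<open>i\<close> if \<open>T\<close> has no common neighbour that lies in the \<open>b\<^sub>i\<close>-block of \<open>p\<close>, but in
  a later \<open>b\<^bsub>i+1\<^esub>\<close>-block. As the bad \<open>p\<close> for a given \<open>T\<close> occupy at most one \<open>b\<^bsub>i+1\<^esub>\<close>-block in each
  \<open>b\<^sub>i\<close>-block, the maximality of \<open>I\<close> makes them rare. Hence in the common neighbourhood of random rows
  \<open>p, p\<^sub>2, \<dots>, p\<^sub>t\<close> of \<open>I\<close> most \<open>t\<close>-sets are good at all scales, and \<open>J\<^sub>i\<close> consists of the rows separated
  from \<open>p\<close> at a given scale.
\<close>

section \<open>Power means and random choice\<close>

text \<open>The graph of the \<open>t\<close>-th power lies above its tangent at the mean
  \<open>a\<close> (Bernoulli); the linear terms of the tangents sum to zero over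
  \<open>S\<close>.\<close>

lemma power_mean_sum:
  fixes f :: "'a \<Rightarrow> real"
  assumes "finite S" and "t \<ge> 1" and nonneg: "\<And>x. x \<in> S \<Longrightarrow> f x \<ge> 0"
  shows "(\<Sum>x\<in>S. f x) ^ t \<le> real (card S) ^ (t - 1) * (\<Sum>x\<in>S. f x ^ t)"
proof (cases "(\<Sum>x\<in>S. f x) = 0")
  case True
  then show ?thesis using assms by (simp add: power_0_left sum_nonneg)
next
  case False
  then have ne: "S \<noteq> {}" by auto
  define c where "c = real (card S)"
  have c: "c > 0" using ne assms(1) by (simp add: c_def card_gt_0_iff)
  define a where "a = (\<Sum>x\<in>S. f x) / c"
  have a: "a > 0" using False c nonneg by (simp add: a_def sum_nonneg less_le)
  have tangent: "a ^ t * (1 + real t * (f x / a - 1)) \<le> f x ^ t" if "x \<in> S" for x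
  proof -
    have "1 + real t * (f x / a - 1) \<le> (1 + (f x / a - 1)) ^ t"
      using nonneg[OF that] a by (intro Bernoulli_inequality) simp
    then have "a ^ t * (1 + real t * (f x / a - 1)) \<le> a ^ t * (f x / a) ^ t"
      using a by (intro mult_left_mono) auto
    also have "\<dots> = f x ^ t" using a by (simp add: power_divide)
    finally show ?thesis .
  qed
  have "(\<Sum>x\<in>S. f x / a - 1) = 0"
    using False c by (simp add: sum_subtractf flip: sum_divide_distrib c_def) (simp add: a_def)
  moreover have "(\<Sum>x\<in>S. a ^ t * (1 + real t * (f x / a - 1)))
      = a ^ t * (c + real t * (\<Sum>x\<in>S. f x / a - 1))"
    unfolding sum_distrib_left[symmetric] sum.distrib by (simp add: c_def)
  ultimately have "c * a ^ t = (\<Sum>x\<in>S. a ^ t * (1 + real t * (f x / a - 1)))"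
    by simp
  also have "\<dots> \<le> (\<Sum>x\<in>S. f x ^ t)" by (intro sum_mono tangent)
  finally have *: "c * a ^ t \<le> (\<Sum>x\<in>S. f x ^ t)" .
  have "(\<Sum>x\<in>S. f x) ^ t = (c * a) ^ t" using c by (simp add: a_def)
  also have "\<dots> = c ^ (t - 1) * (c * a ^ t)"
    using \<open>t \<ge> 1\<close> by (cases t) (auto simp: power_mult_distrib)
  also have "\<dots> \<le> c ^ (t - 1) * (\<Sum>x\<in>S. f x ^ t)" using * c by (intro mult_left_mono) auto
  finally show ?thesis by (simp add: c_def)
qed

text \<open>Union bound over the \<open>l\<close>-subsets of \<open>U\<close>: each \<open>T\<close>
  in \<open>B\<close> spoils at most \<open>(u - t) choose (l - t)\<close> of them, and double
  counting of pairs \<open>T \<subseteq> W\<close> (\<open>choose_mult\<close>) turns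
  \<open>few\<close> into the statement that some \<open>W\<close> is left over.\<close>

lemma exists_subset_avoiding:
  assumes fin: "finite U" and tl: "t \<le> l" "l \<le> card U"
    and B: "B \<subseteq> {T. T \<subseteq> U \<and> card T = t}"
    and few: "card B * (l choose t) < card U choose t"
  shows "\<exists>W\<subseteq>U. card W = l \<and> (\<forall>T\<subseteq>W. T \<notin> B)"
proof (rule ccontr)
  assume "\<not> ?thesis"
  then have all_bad: "\<exists>T\<in>B. T \<subseteq> W" if "W \<subseteq> U" "card W = l" for W
    using that by blast
  define u where "u = card U"
  have finB: "finite B" using B fin by (auto intro: finite_subset)
  have sup: "card {W. T \<subseteq> W \<and> W \<subseteq> U \<and> card W = l} \<le> (u - t) choose (l - t)" if "T \<in> B" for T
  proof -
    have T: "T \<subseteq> U" "card T = t" using B that by auto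
    then have "finite T" using fin finite_subset by blast
    have "card {W. T \<subseteq> W \<and> W \<subseteq> U \<and> card W = l} \<le> card {V. V \<subseteq> U - T \<and> card V = l - t}"
    proof (rule card_inj_on_le[where f = "\<lambda>W. W - T"])
      show "inj_on (\<lambda>W. W - T) {W. T \<subseteq> W \<and> W \<subseteq> U \<and> card W = l}"
        by (auto simp: inj_on_def)
      show "(\<lambda>W. W - T) ` {W. T \<subseteq> W \<and> W \<subseteq> U \<and> card W = l} \<subseteq> {V. V \<subseteq> U - T \<and> card V = l - t}"
        using T \<open>finite T\<close> by (auto simp: card_Diff_subset)
      show "finite {V. V \<subseteq> U - T \<and> card V = l - t}" using fin by simp
    qed
    also have "\<dots> = (u - t) choose (l - t)"
      using fin T \<open>finite T\<close> by (simp add: n_subsets card_Diff_subset u_def)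
    finally show ?thesis .
  qed
  have "u choose l = card {W. W \<subseteq> U \<and> card W = l}"
    using fin by (simp add: n_subsets u_def)
  also have "\<dots> \<le> card (\<Union>T\<in>B. {W. T \<subseteq> W \<and> W \<subseteq> U \<and> card W = l})"
    using all_bad fin finB by (intro card_mono) auto
  also have "\<dots> \<le> (\<Sum>T\<in>B. card {W. T \<subseteq> W \<and> W \<subseteq> U \<and> card W = l})"
    using finB by (rule card_UN_le)
  also have "\<dots> \<le> card B * ((u - t) choose (l - t))"
    using sum_bounded_above[of B, OF sup] by simp
  finally have "u choose l \<le> card B * ((u - t) choose (l - t))" .
  from mult_le_mono1[OF this, of "l choose t"]
  have "(u choose l) * (l choose t) \<le> card B * (l choose t) * ((u - t) choose (l - t))"
    by (simp only: ac_simps)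
  moreover have "(u choose l) * (l choose t) = (u choose t) * ((u - t) choose (l - t))"
    using tl by (intro choose_mult) (auto simp: u_def)
  moreover have "card B * (l choose t) * ((u - t) choose (l - t)) < (u choose t) * ((u - t) choose (l - t))"
    using few tl by (intro mult_strict_right_mono) (auto simp: u_def)
  ultimately show False by linarith
qed

text \<open>Depending on whether \<open>x \<le> \<theta> * y\<close>, the first or the second term
  on the right alone suffices. Maximality of the energy controls \<open>t\<close>-th powers of the
  numbers of bad rows, whereas the averaging argument needs the mixed product on the left.\<close>

lemma mult_power_le_Young:
  fixes x y \<theta> :: real
  assumes "0 \<le> x" "0 \<le> y" "0 < \<theta>" "t \<ge> 1"
  shows "x * y ^ (t - 1) \<le> \<theta> * y ^ t + x ^ t / \<theta> ^ (t - 1)"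
proof (cases "x \<le> \<theta> * y")
  case True
  have "x * y ^ (t - 1) \<le> \<theta> * y * y ^ (t - 1)" using True assms by (intro mult_right_mono) auto
  also have "\<dots> = \<theta> * y ^ t" using assms by (cases t) auto
  finally show ?thesis using assms by (simp add: add_increasing2)
next
  case False
  then have "\<theta> * y \<le> x" by simp
  then have "x * (\<theta> * y) ^ (t - 1) \<le> x * x ^ (t - 1)"
    using assms by (intro mult_left_mono power_mono) auto
  also have "\<dots> = x ^ t" using assms by (cases t) auto
  finally have "x * y ^ (t - 1) \<le> x ^ t / \<theta> ^ (t - 1)"
    using assms by (simp add: field_simps power_mult_distrib)
  then show ?thesis using assms by (simp add: add_increasing)
qed

text \<open>First moment over all \<open>t\<close>-tuples \<open>(p, xs)\<close> of elements of
  \<open>I\<close>. The row \<open>p\<close> is kept apart from \<open>xs\<close> because badness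
  refers to \<open>p\<close> alone. By \<open>few\<close>, the bad sets, even with weight
  \<open>c\<close>, account for at most half of the expected count; the other half is the guaranteed
  surplus.\<close>

lemma random_common_neighbourhood:
  fixes N Bd :: "'c \<Rightarrow> 'a set" and c :: real
  assumes fin: "finite TT" "finite I" and "I \<noteq> {}" and "t \<ge> 1" and "c \<ge> 0"
    and N: "\<And>T. T \<in> TT \<Longrightarrow> N T \<subseteq> I" and Bd: "\<And>T. T \<in> TT \<Longrightarrow> Bd T \<subseteq> N T"
    and few: "c * (\<Sum>T\<in>TT. real (card (Bd T)) * real (card (N T)) ^ (t - 1))
               \<le> (\<Sum>T\<in>TT. real (card (N T)) ^ t) / 2"
  obtains p xs where "p \<in> I" "set xs \<subseteq> I" "length xs = t - 1"
    "c * real (card {T\<in>TT. p \<in> Bd T \<and> set xs \<subseteq> N T})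
       + (\<Sum>T\<in>TT. real (card (N T)) ^ t) / 2 / real (card I) ^ t
     \<le> real (card {T\<in>TT. p \<in> N T \<and> set xs \<subseteq> N T})"
proof -
  define S where "S = (\<Sum>T\<in>TT. real (card (N T)) ^ t)"
  define L where "L = {xs. set xs \<subseteq> I \<and> length xs = t - 1}"
  have finL: "finite L" using fin by (simp add: L_def finite_lists_length_eq)
  \<comment> \<open>For fixed \<open>T\<close> there are \<open>card (M T)\<close> choices of
    \<open>p\<close> and \<open>card (N T)\<close> choices for each entry of \<open>xs\<close>; both
    \<open>Bd\<close> and \<open>N\<close> are inserted for \<open>M\<close> below.\<close>
  have count: "(\<Sum>(p, xs)\<in>I \<times> L. real (card {T\<in>TT. p \<in> M T \<and> set xs \<subseteq> N T}))
      = (\<Sum>T\<in>TT. real (card (M T)) * real (card (N T)) ^ (t - 1))"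
    if M: "\<And>T. T \<in> TT \<Longrightarrow> M T \<subseteq> I" for M
  proof -
    have "(\<Sum>(p, xs)\<in>I \<times> L. real (card {T\<in>TT. p \<in> M T \<and> set xs \<subseteq> N T}))
      = (\<Sum>(p, xs)\<in>I \<times> L. \<Sum>T\<in>TT. of_bool (p \<in> M T \<and> set xs \<subseteq> N T))"
      using fin by (intro sum.cong refl) (auto simp: sum_of_bool_eq Int_def)
    also have "\<dots> = (\<Sum>T\<in>TT. \<Sum>q\<in>I \<times> L. of_bool (fst q \<in> M T \<and> set (snd q) \<subseteq> N T))"
      by (subst sum.swap) (simp add: case_prod_beta)
    also have "\<dots> = (\<Sum>T\<in>TT. real (card (M T)) * real (card (N T)) ^ (t - 1))"
    proof (intro sum.cong refl)
      fix T assume T: "T \<in> TT"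
      have "(\<Sum>q\<in>I \<times> L. of_bool (fst q \<in> M T \<and> set (snd q) \<subseteq> N T) :: real)
        = real (card ({q. fst q \<in> M T \<and> set (snd q) \<subseteq> N T} \<inter> (I \<times> L)))"
        using fin finL by (simp add: sum_of_bool_eq Int_commute)
      also have "{q. fst q \<in> M T \<and> set (snd q) \<subseteq> N T} \<inter> (I \<times> L)
        = M T \<times> {xs. set xs \<subseteq> N T \<and> length xs = t - 1}"
        using M[OF T] N[OF T] by (auto simp: L_def)
      also have "real (card \<dots>) = real (card (M T)) * real (card (N T)) ^ (t - 1)"
        using finite_subset[OF N[OF T] fin(2)]
        by (simp add: card_cartesian_product card_lists_length_eq)
      finally show "(\<Sum>q\<in>I \<times> L. of_bool (fst q \<in> M T \<and> set (snd q) \<subseteq> N T) :: real)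
        = real (card (M T)) * real (card (N T)) ^ (t - 1)" .
    qed
    finally show ?thesis .
  qed
  have "\<exists>(p, xs)\<in>I \<times> L. c * real (card {T\<in>TT. p \<in> Bd T \<and> set xs \<subseteq> N T})
       + S / 2 / real (card I) ^ t \<le> real (card {T\<in>TT. p \<in> N T \<and> set xs \<subseteq> N T})"
  proof (rule ccontr)
    assume "\<not> ?thesis"
    then have "(\<Sum>(p, xs)\<in>I \<times> L. real (card {T\<in>TT. p \<in> N T \<and> set xs \<subseteq> N T}))
      < (\<Sum>(p, xs)\<in>I \<times> L. c * real (card {T\<in>TT. p \<in> Bd T \<and> set xs \<subseteq> N T})
            + S / 2 / real (card I) ^ t)"
    proof (intro sum_strict_mono)
      obtain p where "p \<in> I" using \<open>I \<noteq> {}\<close> by blast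
      then have "(p, replicate (t - 1) p) \<in> I \<times> L" by (auto simp: L_def)
      then show "I \<times> L \<noteq> {}" by blast
    qed (use fin finL in \<open>auto simp: not_le\<close>)
    also have "\<dots> = c * (\<Sum>(p, xs)\<in>I \<times> L. real (card {T\<in>TT. p \<in> Bd T \<and> set xs \<subseteq> N T})) +
       real (card (I \<times> L)) * (S / 2 / real (card I) ^ t)"
      by (simp add: case_prod_beta sum.distrib sum_distrib_left)
    also have "card (I \<times> L) = card I ^ t"
      using fin \<open>t \<ge> 1\<close> by (cases t) (auto simp: L_def card_cartesian_product card_lists_length_eq)
    also have "real (card I ^ t) * (S / 2 / real (card I) ^ t) = S / 2"
      using fin \<open>I \<noteq> {}\<close> by simp
    also have "c * (\<Sum>(p, xs)\<in>I \<times> L. real (card {T\<in>TT. p \<in> Bd T \<and> set xs \<subseteq> N T}))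
       = c * (\<Sum>T\<in>TT. real (card (Bd T)) * real (card (N T)) ^ (t - 1))"
      using N Bd by (subst count) auto
    also have "\<dots> + S / 2 \<le> S" using few by (simp add: S_def)
    also have "S = (\<Sum>(p, xs)\<in>I \<times> L. real (card {T\<in>TT. p \<in> N T \<and> set xs \<subseteq> N T}))"
      using count[of N, OF N] \<open>t \<ge> 1\<close> by (cases t) (simp_all add: S_def)
    finally show False by simp
  qed
  then show ?thesis using that unfolding S_def L_def by blast
qed

section \<open>Bad rows at one scale\<close>

text \<open>\<open>A r\<close> is the set of columns in which row \<open>r\<close> has a one. A
  vertex of rank \<open>i\<close> on the row side is later embedded into \<open>J i\<close>, so
  order is preserved whichever row of \<open>J i\<close> is taken.\<close>

definition order_rich :: "(nat \<Rightarrow> 'c set) \<Rightarrow> nat set \<Rightarrow> nat \<Rightarrow> nat \<Rightarrow> 'c set \<Rightarrow> bool" where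
  "order_rich A R t k W \<longleftrightarrow> (\<exists>J :: nat \<Rightarrow> nat set.
     (\<forall>i<k. J i \<subseteq> R) \<and>
     (\<forall>i j. i < j \<and> j < k \<longrightarrow> (\<forall>r\<in>J i. \<forall>r'\<in>J j. r < r')) \<and>
     (\<forall>i<k. \<forall>T\<subseteq>W. card T = t \<longrightarrow> (\<exists>r\<in>J i. T \<subseteq> A r)))"

lemma order_richI:
  assumes "\<And>i. i < k \<Longrightarrow> J i \<subseteq> R"
    and "\<And>i j r r'. i < j \<Longrightarrow> j < k \<Longrightarrow> r \<in> J i \<Longrightarrow> r' \<in> J j \<Longrightarrow> r < r'"
    and "\<And>i T. i < k \<Longrightarrow> T \<subseteq> W \<Longrightarrow> card T = t \<Longrightarrow> \<exists>r\<in>J i. T \<subseteq> A r"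
  shows "order_rich A R t k W"
  unfolding order_rich_def using assms by (intro exI[of _ J] conjI) blast+

lemma order_richE:
  assumes "order_rich A R t k W"
  obtains J where "\<forall>i<k. J i \<subseteq> R"
    and "\<forall>i j. i < j \<longrightarrow> j < k \<longrightarrow> (\<forall>r\<in>J i. \<forall>r'\<in>J j. r < r')"
    and "\<forall>i<k. \<forall>T\<subseteq>W. card T = t \<longrightarrow> (\<exists>r\<in>J i. T \<subseteq> A r)"
proof -
  obtain J where J: "(\<forall>i<k. J i \<subseteq> R) \<and>
     (\<forall>i j. i < j \<and> j < k \<longrightarrow> (\<forall>r\<in>J i. \<forall>r'\<in>J j. r < r')) \<and>
     (\<forall>i<k. \<forall>T\<subseteq>W. card T = t \<longrightarrow> (\<exists>r\<in>J i. T \<subseteq> A r))"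
    using assms unfolding order_rich_def by (rule exE)
  show thesis by (rule that[of J]) (use J in blast)+
qed

lemma order_rich_mono:
  assumes "order_rich A R t k W" "R \<subseteq> R'"
  shows "order_rich A R' t k W"
proof -
  obtain J where J: "\<forall>i<k. J i \<subseteq> R"
    "\<forall>i j. i < j \<longrightarrow> j < k \<longrightarrow> (\<forall>r\<in>J i. \<forall>r'\<in>J j. r < r')"
    "\<forall>i<k. \<forall>T\<subseteq>W. card T = t \<longrightarrow> (\<exists>r\<in>J i. T \<subseteq> A r)"
    using assms(1) by (rule order_richE)
  note J = J[rule_format]
  show ?thesis by (rule order_richI[of k J, OF order_trans[OF J(1) assms(2)] J(2,3)])
qed

text \<open>For \<open>X\<close> the common neighbours of a \<open>t\<close>-set, these are the bad
  rows between the scales \<open>B\<close> and \<open>b\<close>: no later \<open>b\<close>-block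
  inside the same \<open>B\<close>-block meets \<open>X\<close>. Blocks are aligned at multiples of
  their length.\<close>

definition last_in_block :: "nat \<Rightarrow> nat \<Rightarrow> nat set \<Rightarrow> nat set" where
  "last_in_block b B X = {p \<in> X. \<forall>r\<in>X. r div B = p div B \<longrightarrow> r div b \<le> p div b}"

lemma binomial_left_mono: "m \<le> n \<Longrightarrow> m choose k \<le> n choose k"
proof (induction rule: dec_induct)
  case (step n)
  then show ?case by (cases k) simp_all
qed simp

text \<open>The summand 2 is the price of alignment: both ends of the interval may cut a
  block.\<close>

lemma card_blocks_le:
  fixes a b c :: nat
  assumes "b > 0"
  shows "card ((\<lambda>r. r div b) ` {a..<c}) \<le> (c - a) div b + 2"
proof (cases "a \<le> c")
  case True
  have "(\<lambda>r. r div b) ` {a..<c} \<subseteq> {a div b..c div b}"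
    by (auto simp: div_le_mono)
  then have "card ((\<lambda>r. r div b) ` {a..<c}) \<le> card {a div b..c div b}"
    by (intro card_mono) auto
  also have "\<dots> = c div b + 1 - a div b" by simp
  finally have *: "card ((\<lambda>r. r div b) ` {a..<c}) \<le> c div b + 1 - a div b" .
  have "c div b = (a + (c - a)) div b" using True by simp
  also have "\<dots> = a div b + (c - a) div b + (a mod b + (c - a) mod b) div b"
    by (rule div_add1_eq)
  finally have "c div b = a div b + (c - a) div b + (a mod b + (c - a) mod b) div b" .
  moreover have "a mod b + (c - a) mod b < 2 * b"
    using assms by (simp add: add_strict_mono mult_2)
  then have "(a mod b + (c - a) mod b) div b < 2"
    using assms by (simp add: less_mult_imp_div_less)
  ultimately show ?thesis using * by linarith
qed simp

text \<open>Each \<open>B\<close>-block contains at most one \<open>b\<close>-block with elements of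
  \<open>last_in_block b B X\<close>. Hence these elements occupy no more \<open>b\<close>-blocks
  than there are \<open>B\<close>-blocks, and the power mean inequality over the occupied blocks
  applies.\<close>

lemma card_last_in_block_power_le:
  assumes "b > 0" "b dvd B" "t \<ge> 1" and X: "X \<subseteq> I" and fin: "finite I"
  shows "real (card (last_in_block b B X)) ^ t
    \<le> real (card ((\<lambda>r. r div B) ` I)) ^ (t - 1)
       * (\<Sum>h\<in>(\<lambda>r. r div b) ` I. real (card {r \<in> X. r div b = h}) ^ t)"
proof -
  define L where "L = last_in_block b B X"
  obtain q where q: "B = b * q" using \<open>b dvd B\<close> by blast
  have LX: "L \<subseteq> X" by (auto simp: L_def last_in_block_def)
  have finX: "finite X" using X fin by (rule finite_subset)
  have finL: "finite L" using LX finX by (rule finite_subset)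
  define H where "H = (\<lambda>r. r div b) ` L"
  \<comment> \<open>As \<open>b\<close> divides \<open>B\<close>, the index of the
    \<open>B\<close>-block is a function of the index of the \<open>b\<close>-block, namely
    \<open>h div q\<close>. Two occupied \<open>b\<close>-blocks in one \<open>B\<close>-block would
    both have to be the last one.\<close>
  have "inj_on (\<lambda>h. h div q) H"
  proof (rule inj_onI)
    fix h h' assume "h \<in> H" "h' \<in> H" and eq: "h div q = h' div q"
    then obtain p p' where p: "p \<in> L" "h = p div b" "p' \<in> L" "h' = p' div b"
      by (auto simp: H_def)
    then have "p div B = p' div B" using eq by (simp add: q div_mult2_eq)
    then have "p' div b \<le> p div b" "p div b \<le> p' div b"
      using p by (auto simp: L_def last_in_block_def)
    then show "h = h'" using p by simp
  qed
  moreover have "(\<lambda>h. h div q) ` H \<subseteq> (\<lambda>r. r div B) ` I"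
    using LX X by (auto simp: H_def q div_mult2_eq)
  ultimately have cardH: "card H \<le> card ((\<lambda>r. r div B) ` I)"
    using fin by (intro card_inj_on_le) auto
  have "real (card L) = (\<Sum>h\<in>H. real (card {p \<in> L. p div b = h}))"
    unfolding H_def using sum.image_gen[OF finL, of "\<lambda>_. 1 :: real" "\<lambda>r. r div b"] by simp
  then have "real (card L) ^ t \<le> real (card H) ^ (t - 1) * (\<Sum>h\<in>H. real (card {p \<in> L. p div b = h}) ^ t)"
    using power_mean_sum[of H t] finL \<open>t \<ge> 1\<close> by (simp add: H_def)
  also have "\<dots> \<le> real (card ((\<lambda>r. r div B) ` I)) ^ (t - 1)
       * (\<Sum>h\<in>(\<lambda>r. r div b) ` I. real (card {r \<in> X. r div b = h}) ^ t)"
  proof (intro mult_mono power_mono sum_nonneg zero_le_power)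
    have "(\<Sum>h\<in>H. real (card {p \<in> L. p div b = h}) ^ t) \<le> (\<Sum>h\<in>H. real (card {r \<in> X. r div b = h}) ^ t)"
      using LX finX by (intro sum_mono power_mono of_nat_mono card_mono) auto
    also have "\<dots> \<le> (\<Sum>h\<in>(\<lambda>r. r div b) ` I. real (card {r \<in> X. r div b = h}) ^ t)"
      using LX X fin by (intro sum_mono2) (auto simp: H_def)
    finally show "(\<Sum>h\<in>H. real (card {p \<in> L. p div b = h}) ^ t)
       \<le> (\<Sum>h\<in>(\<lambda>r. r div b) ` I. real (card {r \<in> X. r div b = h}) ^ t)" .
  qed (use cardH in auto)
  finally show ?thesis by (simp add: L_def)
qed

lemma interval_block_eq:
  fixes a b c h :: nat
  assumes "b > 0"
  shows "{r \<in> {a..<c}. r div b = h} = {max a (h * b)..<min c (h * b + b)}"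
proof -
  have "r div b = h \<longleftrightarrow> h * b \<le> r \<and> r < h * b + b" for r
    using assms dividend_less_div_times[of b r] div_times_less_eq_dividend[of r b]
    by (auto intro!: div_nat_eqI simp: mult.commute add.commute)
  then show ?thesis
    by (simp only: set_eq_iff mem_Collect_eq atLeastLessThan_iff max.bounded_iff min_less_iff_conj) blast
qed

section \<open>Energy of a set of rows and the consequences of its maximality\<close>

locale rows =
  fixes A :: "nat \<Rightarrow> 'c set" and C :: "'c set" and t :: nat
  assumes finC: "finite C" and t2: "t \<ge> 2"
begin

definition tsets :: "'c set set" where "tsets = {T. T \<subseteq> C \<and> card T = t}"

definition nbrs :: "nat set \<Rightarrow> 'c set \<Rightarrow> nat set" where "nbrs V T = {r \<in> V. T \<subseteq> A r}"

text \<open>For finite nonempty \<open>V\<close>, division by \<open>card V ^ t\<close> gives the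
  expected number of \<open>t\<close>-sets of columns in the common neighbourhood of
  \<open>t\<close> independent uniform rows of \<open>V\<close>.\<close>

definition energy :: "nat set \<Rightarrow> real" where
  "energy V = (\<Sum>T\<in>tsets. real (card (nbrs V T)) ^ t)"

lemma finite_tsets: "finite tsets"
  using finC by (simp add: tsets_def)

lemma energy_nonneg: "energy V \<ge> 0"
  by (simp add: energy_def sum_nonneg)

text \<open>After \<open>card_last_in_block_power_le\<close>, what remains is the total energy of
  the \<open>b\<close>-blocks. Maximality bounds the energy of each block superlinearly in its
  length: the linear factors sum to 1, and the excess exponent \<open>\<kappa>\<close> leaves the
  gain \<open>(b / (c - a)) powr \<kappa>\<close>. The loss is a power of the number of
  \<open>B\<close>-blocks.\<close>

lemma sum_last_in_block_le:
  assumes ac: "a < c" and b: "b > 0" "b dvd B" "B > 0" and "\<kappa> \<ge> 0"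
    and max: "\<And>x y. a \<le> x \<Longrightarrow> x < y \<Longrightarrow> y \<le> c \<Longrightarrow>
      energy {x..<y} \<le> energy {a..<c} * (real (y - x) / real (c - a)) powr (1 + \<kappa>)"
  shows "(\<Sum>T\<in>tsets. real (card (last_in_block b B (nbrs {a..<c} T))) ^ t)
    \<le> real ((c - a) div B + 2) ^ (t - 1) * (real b / real (c - a)) powr \<kappa> * energy {a..<c}"
proof -
  define I where "I = {a..<c}"
  define s where "s = real (c - a)"
  have s: "s > 0" using ac by (simp add: s_def)
  define g where "g = real (card ((\<lambda>r. r div B) ` I)) ^ (t - 1)"
  define P where "P h = {r \<in> I. r div b = h}" for h
  have block: "energy (P h) \<le> energy I * (real b / s) powr \<kappa> * (real (card (P h)) / s)"
    if h: "h \<in> (\<lambda>r. r div b) ` I" for h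
  proof -
    define x y where "x = max a (h * b)" and "y = min c (h * b + b)"
    have P: "P h = {x..<y}" unfolding P_def I_def x_def y_def by (rule interval_block_eq[OF b(1)])
    moreover have "P h \<noteq> {}" using h by (auto simp: P_def)
    ultimately have xy: "x < y" by auto
    have "y - x \<le> b" by (auto simp: x_def y_def)
    have "energy (P h) \<le> energy I * (real (y - x) / s) powr (1 + \<kappa>)"
      unfolding P I_def s_def using xy by (intro max) (auto simp: x_def y_def)
    also have "(real (y - x) / s) powr (1 + \<kappa>) = (real (y - x) / s) powr \<kappa> * (real (y - x) / s)"
      using xy s by (simp add: powr_add)
    also have "\<dots> \<le> (real b / s) powr \<kappa> * (real (y - x) / s)"
      using \<open>y - x \<le> b\<close> s \<open>\<kappa> \<ge> 0\<close> by (intro mult_right_mono powr_mono2 divide_right_mono) auto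
    finally show ?thesis using P by (simp add: mult_left_mono energy_nonneg mult.assoc)
  qed
  have "(\<Sum>T\<in>tsets. real (card (last_in_block b B (nbrs I T))) ^ t)
    \<le> (\<Sum>T\<in>tsets. g * (\<Sum>h\<in>(\<lambda>r. r div b) ` I. real (card {r \<in> nbrs I T. r div b = h}) ^ t))"
    unfolding g_def using b t2
    by (intro sum_mono card_last_in_block_power_le) (auto simp: nbrs_def I_def)
  also have "\<dots> = g * (\<Sum>h\<in>(\<lambda>r. r div b) ` I. \<Sum>T\<in>tsets. real (card {r \<in> nbrs I T. r div b = h}) ^ t)"
    by (subst sum.swap) (simp add: sum_distrib_left)
  also have "\<dots> = g * (\<Sum>h\<in>(\<lambda>r. r div b) ` I. energy (P h))"
    by (intro arg_cong[of _ _ "(*) g"] sum.cong refl)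
       (auto simp: energy_def nbrs_def P_def intro!: sum.cong arg_cong[where f = card] arg_cong[where f = "\<lambda>x. real x ^ t"])
  also have "\<dots> \<le> g * (\<Sum>h\<in>(\<lambda>r. r div b) ` I. energy I * (real b / s) powr \<kappa> * (real (card (P h)) / s))"
    by (intro mult_left_mono sum_mono block) (auto simp: g_def)
  also have "\<dots> = g * (energy I * (real b / s) powr \<kappa> * ((\<Sum>h\<in>(\<lambda>r. r div b) ` I. real (card (P h))) / s))"
    by (simp add: sum_distrib_left sum_divide_distrib)
  also have "(\<Sum>h\<in>(\<lambda>r. r div b) ` I. real (card (P h))) = s"
    unfolding P_def using sum.image_gen[of I "\<lambda>_. 1 :: real" "\<lambda>r. r div b"]
    by (simp add: I_def s_def)
  also have "g * (energy I * (real b / s) powr \<kappa> * (s / s))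
     \<le> real ((c - a) div B + 2) ^ (t - 1) * (energy I * (real b / s) powr \<kappa> * (s / s))"
    unfolding g_def I_def using s b
    by (intro mult_right_mono power_mono of_nat_mono card_blocks_le) (auto simp: energy_nonneg)
  finally show ?thesis using s by (simp add: I_def s_def mult_ac)
qed

text \<open>Dependent random choice in \<open>{a..<c}\<close>: the hypothesis \<open>scale\<close>
  makes bad rows rare at each of the \<open>k\<close> scales, and \<open>dense\<close> makes the
  random common neighbourhood large enough to contain an \<open>l\<close>-set all of whose
  \<open>t\<close>-subsets are good.\<close>

lemma order_rich_if_energy_maximal:
  assumes ac: "a < c" "c \<le> N" and A: "\<And>r. r < N \<Longrightarrow> A r \<subseteq> C" and "\<kappa> \<ge> 0" and "t \<le> l"
    and max: "\<And>x y. a \<le> x \<Longrightarrow> x < y \<Longrightarrow> y \<le> c \<Longrightarrow>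
      energy {x..<y} \<le> energy {a..<c} * (real (y - x) / real (c - a)) powr (1 + \<kappa>)"
    and b: "\<And>i. i \<le> k \<Longrightarrow> b i > 0" "\<And>i. i < k \<Longrightarrow> b (Suc i) dvd b i"
    and scale: "\<And>i. i < k \<Longrightarrow>
      real ((c - a) div b i + 2) ^ (t - 1) * (real (b (Suc i)) / real (c - a)) powr \<kappa> \<le> \<theta> ^ t"
    and \<theta>: "\<theta> > 0" "4 * real (l choose t) * real k * \<theta> \<le> 1"
    and dense: "2 * real (l choose t) < energy {a..<c} / real (c - a) ^ t"
  shows "\<exists>W\<subseteq>C. card W = l \<and> order_rich A {..<N} t k W"
proof -
  define I where "I = {a..<c}"
  define S where "S = energy I"
  have cardI: "card I = c - a" by (simp add: I_def)
  have "0 \<le> 2 * real (l choose t)" by simp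
  then have "energy I / real (c - a) ^ t > 0" unfolding I_def using dense by linarith
  then have S: "S > 0" using ac by (simp add: S_def zero_less_divide_iff)
  define bad where "bad T = (\<Union>i<k. last_in_block (b (Suc i)) (b i) (nbrs I T))" for T
  \<comment> \<open>Young's inequality with the very \<open>\<theta>\<close> of \<open>scale\<close>
    balances the two terms: each is at most \<open>\<theta> * S\<close>.\<close>
  have one: "(\<Sum>T\<in>tsets. real (card (last_in_block (b (Suc i)) (b i) (nbrs I T))) * real (card (nbrs I T)) ^ (t - 1))
     \<le> 2 * \<theta> * S" if i: "i < k" for i
  proof -
    let ?L = "\<lambda>T. last_in_block (b (Suc i)) (b i) (nbrs I T)"
    have "(\<Sum>T\<in>tsets. real (card (?L T)) ^ t)
      \<le> real ((c - a) div b i + 2) ^ (t - 1) * (real (b (Suc i)) / real (c - a)) powr \<kappa> * S"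
      unfolding I_def S_def using i b(2)[of i] b(1)[of i] b(1)[of "Suc i"] ac \<open>\<kappa> \<ge> 0\<close>
      by (intro sum_last_in_block_le max) auto
    also have "\<dots> \<le> \<theta> ^ t * S" using scale[OF i] S by (intro mult_right_mono) auto
    finally have *: "(\<Sum>T\<in>tsets. real (card (?L T)) ^ t) / \<theta> ^ (t - 1) \<le> \<theta> ^ t * S / \<theta> ^ (t - 1)"
      using \<theta> by (intro divide_right_mono) auto
    have "(\<Sum>T\<in>tsets. real (card (?L T)) * real (card (nbrs I T)) ^ (t - 1))
      \<le> (\<Sum>T\<in>tsets. \<theta> * real (card (nbrs I T)) ^ t + real (card (?L T)) ^ t / \<theta> ^ (t - 1))"
      using \<theta> t2 by (intro sum_mono mult_power_le_Young) auto
    also have "\<dots> = \<theta> * S + (\<Sum>T\<in>tsets. real (card (?L T)) ^ t) / \<theta> ^ (t - 1)"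
      by (simp add: S_def energy_def sum.distrib sum_distrib_left sum_divide_distrib)
    also have "\<dots> \<le> \<theta> * S + \<theta> ^ t * S / \<theta> ^ (t - 1)" using * by simp
    also have "\<theta> ^ t = \<theta> * \<theta> ^ (t - 1)" using t2 by (cases t) auto
    finally show ?thesis using \<theta> by (simp add: mult.commute mult.left_commute)
  qed
  have card_bad: "real (card (bad T)) \<le> (\<Sum>i<k. real (card (last_in_block (b (Suc i)) (b i) (nbrs I T))))" for T
    using of_nat_mono[OF card_UN_le[of "{..<k}" "\<lambda>i. last_in_block (b (Suc i)) (b i) (nbrs I T)"], where 'a = real]
    by (simp add: bad_def)
  have "(\<Sum>T\<in>tsets. real (card (bad T)) * real (card (nbrs I T)) ^ (t - 1))
    \<le> (\<Sum>T\<in>tsets. (\<Sum>i<k. real (card (last_in_block (b (Suc i)) (b i) (nbrs I T)))) * real (card (nbrs I T)) ^ (t - 1))"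
    by (intro sum_mono mult_right_mono card_bad) auto
  also have "\<dots> = (\<Sum>i<k. \<Sum>T\<in>tsets. real (card (last_in_block (b (Suc i)) (b i) (nbrs I T))) * real (card (nbrs I T)) ^ (t - 1))"
    by (subst sum.swap) (simp add: sum_distrib_right)
  also have "\<dots> \<le> (\<Sum>i<k. 2 * \<theta> * S)" by (intro sum_mono one) auto
  finally have "real (l choose t) * (\<Sum>T\<in>tsets. real (card (bad T)) * real (card (nbrs I T)) ^ (t - 1))
    \<le> real (l choose t) * (\<Sum>i<k. 2 * \<theta> * S)"
    by (rule mult_left_mono) simp
  \<comment> \<open>The second condition on \<open>\<theta>\<close> is made for this point: all
    \<open>k\<close> scales together, weighted by \<open>l choose t\<close>, consume at most half of
    the energy.\<close>
  also have "\<dots> = (4 * real (l choose t) * real k * \<theta>) * S / 2" by simp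
  also have "\<dots> \<le> 1 * S / 2" using \<theta> S by (intro divide_right_mono mult_right_mono) auto
  finally have few: "real (l choose t) * (\<Sum>T\<in>tsets. real (card (bad T)) * real (card (nbrs I T)) ^ (t - 1))
    \<le> (\<Sum>T\<in>tsets. real (card (nbrs I T)) ^ t) / 2"
    by (simp add: S_def energy_def)
  have bad_sub: "bad T \<subseteq> nbrs I T" for T by (auto simp: bad_def last_in_block_def)
  obtain p xs where p: "p \<in> I" "set xs \<subseteq> I" "length xs = t - 1"
    and *: "real (l choose t) * real (card {T\<in>tsets. p \<in> bad T \<and> set xs \<subseteq> nbrs I T})
       + S / 2 / real (card I) ^ t \<le> real (card {T\<in>tsets. p \<in> nbrs I T \<and> set xs \<subseteq> nbrs I T})"
    unfolding S_def energy_def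
    by (rule random_common_neighbourhood[OF finite_tsets _ _ _ _ _ bad_sub few, of I])
       (use ac t2 in \<open>auto simp: I_def nbrs_def\<close>)
  define U where "U = A p \<inter> (\<Inter>x\<in>set xs. A x)"
  have "p < N" using p ac by (auto simp: I_def)
  then have UC: "U \<subseteq> C" using A by (auto simp: U_def)
  then have finU: "finite U" using finC finite_subset by blast
  have TU: "{T\<in>tsets. p \<in> nbrs I T \<and> set xs \<subseteq> nbrs I T} = {T. T \<subseteq> U \<and> card T = t}"
  proof -
    have "p \<in> nbrs I T \<and> set xs \<subseteq> nbrs I T \<longleftrightarrow> T \<subseteq> U" for T
      using p by (auto simp: nbrs_def U_def)
    then show ?thesis using UC by (simp add: tsets_def) blast
  qed
  \<comment> \<open>The \<open>t\<close>-sets inside \<open>U\<close> that are bad for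
    \<open>p\<close>. The weight \<open>l choose t\<close> in the averaging is the one that
    \<open>exists_subset_avoiding\<close> requires.\<close>
  define F where "F = {T\<in>tsets. p \<in> bad T \<and> set xs \<subseteq> nbrs I T}"
  have ineq: "real (l choose t) * real (card F) + S / 2 / real (card I) ^ t \<le> real (card U choose t)"
    using * unfolding TU F_def n_subsets[OF finU] .
  \<comment> \<open>The surplus term is used twice: its size forces \<open>l \<le> card U\<close>,
    and its positivity gives the strict inequality for \<open>F\<close>.\<close>
  have "real (l choose t) < S / 2 / real (card I) ^ t"
    using dense by (simp add: S_def I_def)
  moreover have "0 \<le> real (l choose t) * real (card F)" by simp
  ultimately have "l choose t < card U choose t" using ineq by linarith
  then have lU: "l \<le> card U" using binomial_left_mono[of "card U" l t] by linarith
  have "S / 2 / real (card I) ^ t > 0" using S ac by (simp add: cardI)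
  then have "real (l choose t) * real (card F) < real (card U choose t)"
    using ineq by linarith
  then have "card F * (l choose t) < card U choose t"
    unfolding of_nat_mult[symmetric] of_nat_less_iff by (simp add: mult.commute)
  moreover have "F \<subseteq> {T. T \<subseteq> U \<and> card T = t}"
    unfolding F_def TU[symmetric] by (auto simp: bad_def last_in_block_def)
  ultimately obtain W where W: "W \<subseteq> U" "card W = l" "\<And>T. T \<subseteq> W \<Longrightarrow> T \<notin> F"
    using exists_subset_avoiding[OF finU \<open>t \<le> l\<close> lU] by metis
  \<comment> \<open>The rows that share the \<open>b i\<close>-block of \<open>p\<close> but lie in
    a later \<open>b (Suc i)\<close>-block. A larger index means closer to \<open>p\<close>, so
    these sets descend; the index is reversed to \<open>k - 1 - i\<close> at the end.\<close>
  define J where "J i = {r \<in> I. r div b i = p div b i \<and> r div b (Suc i) > p div b (Suc i)}" for i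
  have dvd: "b j dvd b i" if "i \<le> j" "j \<le> k" for i j
    using that by (induction rule: dec_induct) (auto intro: dvd_trans[OF b(2)])
  have ord: "r < r'" if "i < j" "j < k" "r \<in> J j" "r' \<in> J i" for i j r r'
  proof -
    have "b j dvd b (Suc i)" using that by (intro dvd) auto
    then obtain q where q: "b (Suc i) = b j * q" by (elim dvdE)
    have "r div b (Suc i) = p div b (Suc i)" using that(3) by (simp add: J_def q div_mult2_eq)
    then have "r div b (Suc i) < r' div b (Suc i)" using that(4) by (simp add: J_def)
    then show ?thesis by (meson div_le_mono linorder_not_le)
  qed
  have hit: "\<exists>r\<in>J i. T \<subseteq> A r" if i: "i < k" and T: "T \<subseteq> W" "card T = t" for i T
  proof -
    have "T \<in> {T\<in>tsets. p \<in> nbrs I T \<and> set xs \<subseteq> nbrs I T}"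
      unfolding TU using W T by auto
    then have "p \<notin> bad T" and pT: "p \<in> nbrs I T" using W(3)[OF T(1)] by (auto simp: F_def)
    then have "p \<notin> last_in_block (b (Suc i)) (b i) (nbrs I T)" using i by (auto simp: bad_def)
    then obtain r where "r \<in> nbrs I T" "r div b i = p div b i" "p div b (Suc i) < r div b (Suc i)"
      using pT by (auto simp: last_in_block_def not_le)
    then show ?thesis by (auto simp: J_def nbrs_def)
  qed
  have "order_rich A {..<N} t k W"
  proof (rule order_richI[of k "\<lambda>i. J (k - 1 - i)"])
    show "J (k - 1 - i) \<subseteq> {..<N}" for i using ac by (auto simp: J_def I_def)
    show "r < r'" if "i < j" "j < k" "r \<in> J (k - 1 - i)" "r' \<in> J (k - 1 - j)" for i j r r'
      by (rule ord[of "k - 1 - j" "k - 1 - i"]) (use that in auto)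
    show "\<exists>r\<in>J (k - 1 - i). T \<subseteq> A r" if "i < k" "T \<subseteq> W" "card T = t" for i T
      by (rule hit) (use that in auto)
  qed
  then show ?thesis using W UC by blast
qed

end

section \<open>Dependent random choice in an interval of maximal energy\<close>

text \<open>\<open>G (Suc i)\<close> is a multiple of \<open>G i\<close> with factor at least
  \<open>((4 * G i) ^ m / \<theta>) powr (1 / \<kappa>)\<close>. Up to a factor 2,
  \<open>G i\<close> will be the ratio of the length of the interval to \<open>b i\<close>, and the
  inequality becomes the condition \<open>scale\<close>. The chain does not depend on the size of
  the matrix.\<close>

lemma exists_fast_growing_divisor_chain:
  fixes \<kappa> \<theta> :: real
  assumes "\<kappa> > 0" "\<theta> > 0"
  shows "\<exists>G :: nat \<Rightarrow> nat. \<forall>i. G i > 0 \<and> G i dvd G (Suc i) \<and>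
    (4 * real (G i)) ^ m \<le> \<theta> * real (G (Suc i)) powr \<kappa>"
proof -
  have "\<exists>G :: nat \<Rightarrow> nat. \<forall>i. G i > 0 \<and> (G i dvd G (Suc i) \<and>
    (4 * real (G i)) ^ m \<le> \<theta> * real (G (Suc i)) powr \<kappa>)"
  proof (rule dependent_nat_choice)
    show "\<exists>x :: nat. x > 0" by blast
  next
    fix x i :: nat assume x: "x > 0"
    define w where "w = (4 * real x) ^ m / \<theta>"
    define y where "y = x * Suc (nat \<lceil>w powr (1 / \<kappa>)\<rceil>)"
    have le_mult: "m \<le> x * m" for m using x by (cases x) auto
    have w: "w > 0" using x assms by (simp add: w_def)
    have "w powr (1 / \<kappa>) \<le> real (Suc (nat \<lceil>w powr (1 / \<kappa>)\<rceil>))" by linarith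
    also have "\<dots> \<le> real y" unfolding y_def by (intro of_nat_mono le_mult)
    finally have "(w powr (1 / \<kappa>)) powr \<kappa> \<le> real y powr \<kappa>"
      using assms by (intro powr_mono2) auto
    then have "w \<le> real y powr \<kappa>" using assms w by (simp add: powr_powr)
    then have "(4 * real x) ^ m \<le> \<theta> * real y powr \<kappa>"
      using assms by (simp add: w_def pos_divide_le_eq mult.commute)
    moreover have "y > 0" "x dvd y" using x by (auto simp: y_def)
    ultimately show "\<exists>y. y > 0 \<and> (x dvd y \<and> (4 * real x) ^ m \<le> \<theta> * real y powr \<kappa>)"
      by blast
  qed
  then show ?thesis by blast
qed

context rows
begin

lemma sum_card_nbrs:
  assumes "\<And>r. r \<in> V \<Longrightarrow> A r \<subseteq> C \<and> card (A r) = \<Delta>" "finite V"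
  shows "(\<Sum>T\<in>tsets. real (card (nbrs V T))) = real (card V) * real (\<Delta> choose t)"
proof -
  have "(\<Sum>T\<in>tsets. real (card (nbrs V T))) = (\<Sum>T\<in>tsets. \<Sum>r\<in>V. of_bool (T \<subseteq> A r))"
    using assms by (simp add: nbrs_def sum_of_bool_eq Int_def)
  also have "\<dots> = (\<Sum>r\<in>V. \<Sum>T\<in>tsets. of_bool (T \<subseteq> A r))" by (rule sum.swap)
  also have "\<dots> = (\<Sum>r\<in>V. real (\<Delta> choose t))"
  proof (intro sum.cong refl)
    fix r assume r: "r \<in> V"
    have "finite (A r)" using assms(1)[OF r] finC finite_subset by blast
    have "(\<Sum>T\<in>tsets. of_bool (T \<subseteq> A r)) = real (card (tsets \<inter> {T. T \<subseteq> A r}))"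
      using finite_tsets by (simp add: sum_of_bool_eq)
    also have "tsets \<inter> {T. T \<subseteq> A r} = {T. T \<subseteq> A r \<and> card T = t}"
      using assms(1)[OF r] by (auto simp: tsets_def)
    also have "card \<dots> = \<Delta> choose t"
      using assms(1)[OF r] \<open>finite (A r)\<close> by (simp add: n_subsets)
    finally show "(\<Sum>T\<in>tsets. of_bool (T \<subseteq> A r)) = real (\<Delta> choose t)" .
  qed
  finally show ?thesis by simp
qed

text \<open>Power mean inequality for the codegrees, whose sum counts pairs of a row and a
  \<open>t\<close>-set in it.\<close>

lemma energy_lower_bound:
  assumes "\<And>r. r \<in> V \<Longrightarrow> A r \<subseteq> C \<and> card (A r) = \<Delta>" "finite V"
  shows "(real (card V) * real (\<Delta> choose t)) ^ t \<le> real (card C choose t) ^ (t - 1) * energy V"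
proof -
  have "card tsets = card C choose t" using finC by (simp add: tsets_def n_subsets)
  then show ?thesis
    using power_mean_sum[OF finite_tsets, of t "\<lambda>T. real (card (nbrs V T))"] t2
    by (simp add: sum_card_nbrs[OF assms] energy_def)
qed

lemma energy_upper_bound:
  assumes "\<And>r. r \<in> V \<Longrightarrow> A r \<subseteq> C \<and> card (A r) = \<Delta>" "finite V"
  shows "energy V \<le> real (card V) ^ t * real (\<Delta> choose t)"
proof -
  have "energy V \<le> (\<Sum>T\<in>tsets. real (card V) ^ (t - 1) * real (card (nbrs V T)))"
    unfolding energy_def
  proof (intro sum_mono)
    fix T
    have "real (card (nbrs V T)) ^ t = real (card (nbrs V T)) ^ (t - 1) * real (card (nbrs V T))"
      using t2 by (cases t) auto
    also have "\<dots> \<le> real (card V) ^ (t - 1) * real (card (nbrs V T))"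
      using assms(2) by (intro mult_right_mono power_mono of_nat_mono card_mono) (auto simp: nbrs_def)
    finally show "real (card (nbrs V T)) ^ t \<le> real (card V) ^ (t - 1) * real (card (nbrs V T))" .
  qed
  also have "\<dots> = real (card V) ^ (t - 1) * (real (card V) * real (\<Delta> choose t))"
    by (simp add: sum_card_nbrs[OF assms] flip: sum_distrib_left)
  also have "\<dots> = real (card V) ^ t * real (\<Delta> choose t)" using t2 by (cases t) auto
  finally show ?thesis .
qed

text \<open>An interval maximising energy over length to the power \<open>1 + \<kappa>\<close> is at
  least as dense as the whole, since \<open>1 + \<kappa> \<le> t\<close>, and it cannot be short,
  since \<open>1 + \<kappa> < t\<close> and its energy is at most its trivial upper bound. So there
  is room for \<open>k\<close> scales.\<close>

lemma order_rich_if_dense: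
  fixes G :: "nat \<Rightarrow> nat"
  assumes A: "\<And>r. r < N \<Longrightarrow> A r \<subseteq> C \<and> card (A r) = \<Delta>" and "N > 0" and "t \<le> l"
    and \<kappa>: "0 < \<kappa>" "\<kappa> < real t - 1"
    and G: "\<And>i. G i > 0" "\<And>i. G i dvd G (Suc i)"
      "\<And>i. (4 * real (G i)) ^ (t - 1) \<le> \<theta> ^ t * real (G (Suc i)) powr \<kappa>"
    and \<theta>: "\<theta> > 0" "4 * real (l choose t) * real k * \<theta> \<le> 1"
    and dense: "2 * real (l choose t) * real (card C choose t) ^ (t - 1) < real (\<Delta> choose t) ^ t"
    and large: "real (G k) powr (real t - 1 - \<kappa>) * real (card C choose t) ^ (t - 1)
      \<le> real N powr (real t - 1 - \<kappa>) * real (\<Delta> choose t) ^ (t - 1)"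
  shows "\<exists>W\<subseteq>C. card W = l \<and> order_rich A {..<N} t k W"
proof -
  define P where "P = {(a, c). a < c \<and> c \<le> N}"
  define \<phi> where "\<phi> = (\<lambda>(a, c). energy {a..<c} / real (c - a) powr (1 + \<kappa>))"
  have "P \<subseteq> {..N} \<times> {..N}" by (auto simp: P_def)
  then have finP: "finite P" using finite_subset by blast
  have P0: "(0, N) \<in> P" using \<open>N > 0\<close> by (simp add: P_def)
  have "Max (\<phi> ` P) \<in> \<phi> ` P" using finP P0 by (intro Max_in) auto
  then obtain a c where acP: "(a, c) \<in> P" and "\<phi> (a, c) = Max (\<phi> ` P)" by force
  then have max\<phi>: "\<phi> q \<le> \<phi> (a, c)" if "q \<in> P" for q using that finP by simp
  have ac: "a < c" "c \<le> N" using acP by (auto simp: P_def)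
  define s where "s = c - a"
  have s: "s > 0" "s \<le> N" using ac by (auto simp: s_def)
  define S where "S = energy {a..<c}"
  define D where "D = real (\<Delta> choose t)"
  define M where "M = real (card C choose t) ^ (t - 1)"
  have "0 \<le> 2 * real (l choose t) * real (card C choose t) ^ (t - 1)" by simp
  then have "0 < real (\<Delta> choose t) ^ t" using dense by linarith
  then have "real (\<Delta> choose t) \<noteq> 0" using t2 by (metis not_numeral_le_zero order_less_irrefl power_eq_0_iff zero_less_iff_neq_zero zero_power)
  then have "\<Delta> choose t > 0" by linarith
  then have D: "D > 0" by (simp add: D_def)
  have "0 \<in> {..<N}" using \<open>N > 0\<close> by simp
  then have "\<Delta> \<le> card C" using A[of 0] finC card_mono by fastforce
  then have M: "M > 0" using \<open>\<Delta> choose t > 0\<close> binomial_left_mono[of \<Delta> "card C" t] by (simp add: M_def)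
  \<comment> \<open>Competitors are all subintervals of \<open>{0..<N}\<close>: the whole one bounds
    \<open>S\<close> from below, those inside \<open>{a..<c}\<close> supply the maximality
    hypothesis of \<open>order_rich_if_energy_maximal\<close>.\<close>
  have max: "energy {x..<y} \<le> S * (real (y - x) / real s) powr (1 + \<kappa>)"
    if "x < y" "y \<le> N" for x y
    using max\<phi>[of "(x, y)"] that ac
    by (simp add: P_def \<phi>_def S_def s_def powr_divide field_simps)
  have "real N ^ t * D ^ t \<le> M * energy {0..<N}"
    using energy_lower_bound[of "{0..<N}" \<Delta>] A by (simp add: D_def M_def power_mult_distrib)
  also have "\<dots> \<le> M * (S * (real N / real s) powr (1 + \<kappa>))"
    using max[of 0 N] \<open>N > 0\<close> M by (intro mult_left_mono) auto
  finally have S_lower: "real N ^ t * D ^ t \<le> M * (S * (real N / real s) powr (1 + \<kappa>))" .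
  have S_upper: "S \<le> real s ^ t * D"
    using energy_upper_bound[of "{a..<c}" \<Delta>] A ac by (simp add: S_def s_def D_def)
  have S_nonneg: "S \<ge> 0" by (simp add: S_def energy_nonneg)
  have Ns: "real N / real s \<ge> 1" using s by simp
  have "S * (real N / real s) powr (1 + \<kappa>) \<le> S * (real N / real s) powr real t"
    using Ns \<kappa> S_nonneg by (intro mult_left_mono powr_mono) auto
  also have "(real N / real s) powr real t = real N ^ t / real s ^ t"
    using s \<open>N > 0\<close> by (simp add: powr_realpow power_divide)
  finally have "M * (S * (real N / real s) powr (1 + \<kappa>)) \<le> M * (S * (real N ^ t / real s ^ t))"
    by (rule mult_left_mono) (use M in simp)
  with S_lower have "real N ^ t * D ^ t \<le> real N ^ t * (M * (S / real s ^ t))"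
    by (simp add: mult_ac)
  then have "D ^ t \<le> M * (S / real s ^ t)"
    by (rule mult_left_le_imp_le) (use \<open>N > 0\<close> in simp)
  moreover have "M * (2 * real (l choose t)) < D ^ t"
    using dense by (simp add: D_def M_def mult_ac)
  ultimately have "M * (2 * real (l choose t)) < M * (S / real s ^ t)" by linarith
  then have dense': "2 * real (l choose t) < S / real s ^ t"
    by (rule mult_left_less_imp_less) (use M in simp)
  \<comment> \<open>Inserting \<open>S \<le> s ^ t * D\<close> into \<open>S_lower\<close> and
    cancelling leaves \<open>N powr e * D ^ (t - 1) \<le> M * s powr e\<close>; with
    \<open>large\<close> this gives \<open>G k \<le> s\<close>.\<close>
  define e where "e = real t - 1 - \<kappa>"
  have e: "e > 0" using \<kappa> by (simp add: e_def)
  have "real N ^ t * D ^ t \<le> M * (real s ^ t * D * (real N / real s) powr (1 + \<kappa>))"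
    using S_lower M S_upper by (smt (verit) mult_left_mono mult_right_mono powr_ge_zero)
  moreover have "D ^ t = D * D ^ (t - 1)" using t2 by (cases t) auto
  ultimately have "real N ^ t * D ^ (t - 1) \<le> M * (real s ^ t * (real N / real s) powr (1 + \<kappa>))"
    using D by (simp add: mult.left_commute)
  moreover have "real s ^ t * (real N / real s) powr (1 + \<kappa>) = real s powr e * real N powr (1 + \<kappa>)"
    using s \<open>N > 0\<close> by (simp add: powr_divide e_def powr_diff powr_add powr_realpow)
  moreover have "real N ^ t = real N powr e * real N powr (1 + \<kappa>)"
    using \<open>N > 0\<close> by (simp add: e_def flip: powr_add powr_realpow)
  ultimately have "real N powr (1 + \<kappa>) * (real N powr e * D ^ (t - 1)) \<le> real N powr (1 + \<kappa>) * (M * real s powr e)"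
    by (simp add: mult_ac)
  then have "real N powr e * D ^ (t - 1) \<le> M * real s powr e"
    by (rule mult_left_le_imp_le) (use \<open>N > 0\<close> in simp)
  then have "M * real (G k) powr e \<le> M * real s powr e"
    using large by (simp add: D_def M_def e_def mult_ac)
  then have "real (G k) powr e \<le> real s powr e" using M by simp
  then have Gs: "G k \<le> s" using e by (metis linorder_not_le of_nat_0_le_iff of_nat_less_iff powr_less_mono2)
  \<comment> \<open>Rounding \<open>s\<close> down to the multiple \<open>z * G k\<close> makes all
    block lengths integers dividing one another. The product \<open>b i * G i\<close> is always
    \<open>z * G k\<close>, which lies between \<open>s / 2\<close> and \<open>s\<close>.\<close>
  define z where "z = s div G k"
  define b where "b i = z * (G k div G i)" for i
  have z: "z > 0" using Gs G(1)[of k] by (simp add: z_def div_greater_zero_iff)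
  have zs: "z * G k \<le> s" by (simp add: z_def)
  have "s < (z + 1) * G k" using G(1)[of k] dividend_less_div_times[of "G k" s] by (simp add: z_def)
  also have "\<dots> \<le> 2 * (z * G k)" using z by (cases z) auto
  finally have sz: "s < 2 * (z * G k)" .
  have dvd: "G i dvd G j" if "i \<le> j" for i j
    using that by (induction rule: dec_induct) (auto intro: dvd_trans G(2))
  have bG: "real (b i) * real (G i) = real (z * G k)" if "i \<le> k" for i
    using dvd[OF that] by (simp add: b_def real_of_nat_div)  (use G(1)[of i] in simp)
  have b_pos: "b i > 0" if "i \<le> k" for i
    using bG[OF that] z G(1)[of k] by (cases "b i = 0") auto
  show ?thesis
  proof (rule order_rich_if_energy_maximal[where b = b and \<theta> = \<theta> and \<kappa> = \<kappa>])
    show "energy {x..<y} \<le> energy {a..<c} * (real (y - x) / real (c - a)) powr (1 + \<kappa>)"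
      if "a \<le> x" "x < y" "y \<le> c" for x y
      using max[of x y] that ac by (simp add: S_def s_def)
    show "b i > 0" if "i \<le> k" for i using that by (rule b_pos)
    show "b (Suc i) dvd b i" if "i < k" for i
    proof -
      have "G (Suc i) dvd G k" using that by (intro dvd) auto
      then obtain u where u: "G k = G (Suc i) * u" by (elim dvdE)
      obtain v where v: "G (Suc i) = G i * v" using G(2)[of i] by (elim dvdE)
      have "G i > 0" "G (Suc i) > 0" by (rule G(1))+
      then have "G k div G i = v * u" "G k div G (Suc i) = u"
        using u v by (simp_all add: mult.assoc)
      then show ?thesis by (simp add: b_def)
    qed
    show "real ((c - a) div b i + 2) ^ (t - 1) * (real (b (Suc i)) / real (c - a)) powr \<kappa> \<le> \<theta> ^ t"
      if i: "i < k" for i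
    proof -
      have "real (s div b i) * real (b i) \<le> real s"
        by (metis div_times_less_eq_dividend of_nat_le_iff of_nat_mult)
      also have "\<dots> \<le> 2 * real (z * G k)" using sz by linarith
      also have "\<dots> = 2 * real (G i) * real (b i)" using bG[of i] i by (simp add: mult.commute)
      finally have "real (s div b i) \<le> 2 * real (G i)"
        by (rule mult_right_le_imp_le) (use b_pos[of i] i in simp)
      \<comment> \<open>The number of \<open>b i\<close>-blocks is at most
        \<open>2 * G i + 2\<close>, and \<open>G i \<ge> 1\<close>; hence the 4 in the growth
        condition on \<open>G\<close>.\<close>
      then have "real (s div b i + 2) \<le> 4 * real (G i)" using G(1)[of i] by simp
      moreover have "real (b (Suc i)) * real (G (Suc i)) \<le> real s"
        using bG[of "Suc i"] zs i by linarith
      then have "real (b (Suc i)) / real s \<le> 1 / real (G (Suc i))"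
        using s G(1)[of "Suc i"] by (simp add: field_simps)
      ultimately have "real (s div b i + 2) ^ (t - 1) * (real (b (Suc i)) / real s) powr \<kappa>
        \<le> (4 * real (G i)) ^ (t - 1) * (1 / real (G (Suc i))) powr \<kappa>"
        using \<kappa> by (intro mult_mono power_mono powr_mono2) auto
      also have "\<dots> \<le> \<theta> ^ t"
        using G(3)[of i] G(1)[of "Suc i"] by (simp add: powr_divide field_simps)
      finally show ?thesis by (simp add: s_def)
    qed
  qed (use ac A \<kappa> \<open>t \<le> l\<close> \<theta> dense' in \<open>auto simp: S_def s_def\<close>)
qed

end

section \<open>Dense matrices: the case \<open>t \<ge> 2\<close>\<close>

definition row :: "(nat \<times> 'c) set \<Rightarrow> nat \<Rightarrow> 'c set" where "row E r = {c. (r, c) \<in> E}"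

text \<open>Serves to pass from selected rows, trimmed to equal size, back to the full
  matrix.\<close>

lemma order_rich_reindex:
  assumes rich: "order_rich A' {..<N} t k W"
    and mono: "\<And>i j. i < j \<Longrightarrow> j < N \<Longrightarrow> f i < f j"
    and f: "\<And>i. i < N \<Longrightarrow> f i \<in> R \<and> A' i \<subseteq> A (f i)"
  shows "order_rich A R t k W"
proof -
  obtain J where J: "\<forall>i<k. J i \<subseteq> {..<N}"
    "\<forall>i j. i < j \<longrightarrow> j < k \<longrightarrow> (\<forall>r\<in>J i. \<forall>r'\<in>J j. r < r')"
    "\<forall>i<k. \<forall>T\<subseteq>W. card T = t \<longrightarrow> (\<exists>r\<in>J i. T \<subseteq> A' r)"
    using rich by (rule order_richE)
  note J = J[rule_format]
  show ?thesis
  proof (rule order_richI[of k "\<lambda>i. f ` J i"])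
    show "f ` J i \<subseteq> R" if "i < k" for i using J(1)[OF that] f by blast
    show "r < r'" if ij: "i < j" "j < k" and r: "r \<in> f ` J i" "r' \<in> f ` J j" for i j r r'
    proof -
      obtain q q' where q: "q \<in> J i" "r = f q" "q' \<in> J j" "r' = f q'" using r by blast
      have "q < q'" "q' < N" using J(2)[of i j q q'] J(1)[of j] ij q by auto
      then show ?thesis using mono q by simp
    qed
    show "\<exists>r\<in>f ` J i. T \<subseteq> A r" if "i < k" "T \<subseteq> W" "card T = t" for i T
    proof -
      have "\<exists>q\<in>J i. T \<subseteq> A' q" using that by (rule J(3))
      then obtain q where "q \<in> J i" "T \<subseteq> A' q" by blast
      moreover have "A' q \<subseteq> A (f q)" using f[of q] J(1)[OF \<open>i < k\<close>] \<open>q \<in> J i\<close> by auto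
      ultimately show ?thesis by blast
    qed
  qed
qed

section \<open>Regularising the row sizes at the cost of a logarithm\<close>

lemma sum_inverse_le_ln:
  assumes "n \<ge> 1"
  shows "(\<Sum>i=1..n. 1 / real i) \<le> 1 + ln (real n)"
  using assms
proof (induction n rule: dec_induct)
  case (step n)
  have "ln (real n / real (Suc n)) \<le> real n / real (Suc n) - 1"
    using step by (intro ln_le_minus_one) auto
  also have "\<dots> = - 1 / real (Suc n)" by (simp add: field_simps)
  finally have "1 / real (Suc n) \<le> ln (real (Suc n)) - ln (real n)"
    using step by (simp add: ln_div)
  then show ?case using step by simp
qed simp

text \<open>The sum of \<open>f\<close> is the sum over \<open>\<Delta>\<close> of the sizes of the
  level sets \<open>{r \<in> R. \<Delta> \<le> f r}\<close>. If each were below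
  \<open>S / (L * \<Delta>)\<close>, the harmonic sum would make the total less than
  \<open>S\<close>.\<close>

lemma exists_heavy_threshold:
  fixes f :: "'a \<Rightarrow> nat"
  assumes fin: "finite R" and le: "\<And>r. r \<in> R \<Longrightarrow> f r \<le> n" and "n \<ge> 1"
  shows "\<exists>\<Delta>\<in>{1..n}. real (\<Sum>r\<in>R. f r) \<le> real (card {r \<in> R. \<Delta> \<le> f r}) * real \<Delta> * (1 + ln (real n))"
proof (rule ccontr)
  define S where "S = real (\<Sum>r\<in>R. f r)"
  define L where "L = 1 + ln (real n)"
  have S: "S \<ge> 0" by (simp only: S_def of_nat_0_le_iff)
  have L: "L > 0" using \<open>n \<ge> 1\<close> by (simp add: L_def add_pos_nonneg)
  assume not_heavy: "\<not> ?thesis"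
  have small: "real (card {r \<in> R. \<Delta> \<le> f r}) < S / L * (1 / real \<Delta>)" if "\<Delta> \<in> {1..n}" for \<Delta>
  proof -
    have "real (card {r \<in> R. \<Delta> \<le> f r}) * real \<Delta> * L < S"
      using not_heavy that unfolding S_def L_def not_le[symmetric] by blast
    then show ?thesis using L that by (simp add: field_simps)
  qed
  have "f r = (\<Sum>\<Delta>=1..n. of_bool (\<Delta> \<le> f r))" if "r \<in> R" for r
  proof -
    have "{1..n} \<inter> {\<Delta>. \<Delta> \<le> f r} = {1..f r}" using le[OF that] by auto
    then show ?thesis by (simp add: sum_of_bool_eq)
  qed
  then have "S = real (\<Sum>r\<in>R. \<Sum>\<Delta>=1..n. of_bool (\<Delta> \<le> f r))" by (simp add: S_def)
  also have "\<dots> = real (\<Sum>\<Delta>=1..n. \<Sum>r\<in>R. of_bool (\<Delta> \<le> f r))" by (subst sum.swap) simp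
  also have "\<dots> = (\<Sum>\<Delta>=1..n. real (card {r \<in> R. \<Delta> \<le> f r}))"
    using fin by (simp add: sum_of_bool_eq Int_def)
  also have "\<dots> < (\<Sum>\<Delta>=1..n. S / L * (1 / real \<Delta>))"
    using \<open>n \<ge> 1\<close> by (intro sum_strict_mono small) auto
  also have "\<dots> = S / L * (\<Sum>\<Delta>=1..n. 1 / real \<Delta>)" by (simp only: sum_distrib_left)
  also have "\<dots> \<le> S / L * L"
    using sum_inverse_le_ln[OF \<open>n \<ge> 1\<close>] L S by (intro mult_left_mono) (auto simp: L_def)
  finally show False using L by simp
qed

lemma eventually_powr_ge:
  fixes a K :: real
  assumes "a > 0"
  shows "\<forall>\<^sub>F n in sequentially. real n powr a > K"
proof -
  have "filterlim (\<lambda>n. real n powr a) at_top sequentially"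
    using assms by real_asymp
  then show ?thesis by (simp add: filterlim_at_top_dense)
qed

lemma eventually_rich_columns_ge2:
  fixes \<epsilon> :: real
  assumes t: "t \<ge> 2" and l: "t \<le> l" and "\<epsilon> > 0"
  shows "\<forall>\<^sub>F n in sequentially. \<forall>E. E \<subseteq> {..<n} \<times> {..<n} \<and> real n powr (2 - 1 / real t + \<epsilon>) \<le> real (card E) \<longrightarrow>
    (\<exists>W\<subseteq>{..<n}. card W = l \<and> order_rich (row E) {..<n} t k W)"
proof -
  \<comment> \<open>Half of \<open>\<epsilon>\<close> absorbs the logarithm from
    \<open>exists_heavy_threshold\<close>. The choice of \<open>\<kappa>\<close> ensures
    \<open>\<kappa> < \<tau> - 1\<close> and \<open>\<kappa> \<le> (\<tau> - 1) * \<eta>\<close>;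
    the latter makes the exponents in \<open>large\<close> match. The summand 1 in
    \<open>\<theta>\<close> avoids division by zero for \<open>k = 0\<close>.\<close>
  define \<eta> where "\<eta> = \<epsilon> / 2"
  define \<tau> where "\<tau> = real t"
  define \<kappa> where "\<kappa> = (\<tau> - 1) * min (1 / 2) \<eta>"
  define e where "e = \<tau> - 1 - \<kappa>"
  define \<theta> where "\<theta> = 1 / (4 * real (l choose t) * real k + 1)"
  have \<eta>: "\<eta> > 0" using \<open>\<epsilon> > 0\<close> by (simp add: \<eta>_def)
  have \<tau>: "\<tau> \<ge> 2" using t by (simp add: \<tau>_def)
  have "\<kappa> \<le> (\<tau> - 1) * (1 / 2)" unfolding \<kappa>_def using \<tau> by (intro mult_left_mono) auto
  moreover have "\<kappa> > 0" unfolding \<kappa>_def using \<tau> \<eta> by auto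
  moreover have \<kappa>\<eta>: "\<kappa> \<le> (\<tau> - 1) * \<eta>" unfolding \<kappa>_def using \<tau> by (intro mult_left_mono) auto
  ultimately have \<kappa>: "0 < \<kappa>" "\<kappa> < \<tau> - 1" using \<tau> by auto
  have "4 * real (l choose t) * real k + 1 > 0" by (simp add: add_nonneg_pos)
  then have \<theta>: "\<theta> > 0" "4 * real (l choose t) * real k * \<theta> \<le> 1" by (auto simp: \<theta>_def)
  obtain G :: "nat \<Rightarrow> nat" where G: "\<And>i. G i > 0" "\<And>i. G i dvd G (Suc i)"
      "\<And>i. (4 * real (G i)) ^ (t - 1) \<le> \<theta> ^ t * real (G (Suc i)) powr \<kappa>"
    using exists_fast_growing_divisor_chain[of \<kappa> "\<theta> ^ t" "t - 1"] \<kappa> \<theta> by auto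
  define Q where "Q = \<tau> * (\<tau> - 1)"
  have Q: "Q > 0" using \<tau> by (simp add: Q_def)
  have "\<forall>\<^sub>F n in sequentially. 1 + ln (real n) \<le> real n powr \<eta>"
    using \<eta> by real_asymp
  moreover have "\<forall>\<^sub>F n in sequentially. real n powr (1 - 1 / \<tau> + \<eta>) > \<tau>"
    using \<eta> \<tau> by (intro eventually_powr_ge) (simp add: add_nonneg_pos)
  moreover have "\<forall>\<^sub>F n in sequentially. real n powr (\<eta> * \<tau> * \<tau>) > 2 * real (l choose t) * \<tau> powr (\<tau> * \<tau>)"
    using \<eta> \<tau> by (intro eventually_powr_ge) simp
  moreover have "\<forall>\<^sub>F n in sequentially. real n powr ((\<tau> - 1) * (\<tau> - 1) * \<eta>) > real (G k) powr e * \<tau> powr Q"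
    using \<eta> \<tau> by (intro eventually_powr_ge) simp
  moreover have "\<forall>\<^sub>F n :: nat in sequentially. n \<ge> 1" by (rule eventually_ge_at_top)
  ultimately show ?thesis
  proof eventually_elim
    case (elim n)
    show ?case
    proof (intro allI impI)
      fix E assume asm: "E \<subseteq> {..<n} \<times> {..<n} \<and> real n powr (2 - 1 / real t + \<epsilon>) \<le> real (card E)"
      have row_sub: "row E r \<subseteq> {..<n}" for r using asm by (auto simp: row_def)
      then have finrow: "finite (row E r)" for r using finite_subset by blast
      have "E = Sigma {..<n} (row E)" using asm by (auto simp: row_def)
      then have cardE: "card E = (\<Sum>r<n. card (row E r))"
        using finrow by (metis card_SigmaI finite_lessThan)
      have "card (row E r) \<le> n" for r using card_mono[OF _ row_sub[of r]] by simp
      then obtain \<Delta> where \<Delta>: "\<Delta> \<in> {1..n}"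
        and heavy: "real (card E) \<le> real (card {r \<in> {..<n}. \<Delta> \<le> card (row E r)}) * real \<Delta> * (1 + ln (real n))"
        using exists_heavy_threshold[of "{..<n}" "\<lambda>r. card (row E r)" n] elim by (auto simp: cardE)
      define R where "R = {r \<in> {..<n}. \<Delta> \<le> card (row E r)}"
      define N where "N = card R"
      have finR: "finite R" by (simp add: R_def)
      have "card R \<le> card {..<n}" by (intro card_mono) (auto simp: R_def)
      then have Nn: "N \<le> n" by (simp add: N_def)
      have n: "real n > 0" using elim by simp
      have "real n powr (2 - 1 / \<tau> + \<eta>) * real n powr \<eta> = real n powr (2 - 1 / real t + \<epsilon>)"
        by (simp add: \<eta>_def \<tau>_def add_ac flip: powr_add)
      also have "\<dots> \<le> real (card E)" using asm by simp
      also have "\<dots> \<le> real N * real \<Delta> * (1 + ln (real n))"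
        using heavy by (simp add: N_def R_def)
      also have "\<dots> \<le> real N * real \<Delta> * real n powr \<eta>"
        using elim(1) by (rule mult_left_mono) simp
      finally have N\<Delta>: "real n powr (2 - 1 / \<tau> + \<eta>) \<le> real N * real \<Delta>"
        by (rule mult_right_le_imp_le) (use n in simp)
      have "0 < real n powr (2 - 1 / \<tau> + \<eta>)" using n by simp
      then have "0 < real N * real \<Delta>" using N\<Delta> by linarith
      then have N: "N > 0" and \<Delta>0: "\<Delta> > 0" by (auto simp: zero_less_mult_iff)
      \<comment> \<open>There are at most \<open>n\<close> heavy rows, so the lower bound on
        \<open>N * \<Delta>\<close> turns into one on \<open>\<Delta>\<close>.\<close>
      have "real n powr (1 - 1 / \<tau> + \<eta>) * real n powr 1 = real n powr (2 - 1 / \<tau> + \<eta>)"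
        by (subst powr_add[symmetric]) (simp add: algebra_simps)
      also have "\<dots> \<le> real \<Delta> * real n powr 1"
        using N\<Delta> mult_right_mono[of "real N" "real n" "real \<Delta>"] Nn by (simp add: mult.commute)
      finally have \<Delta>_lower: "real n powr (1 - 1 / \<tau> + \<eta>) \<le> real \<Delta>"
        by (rule mult_right_le_imp_le) (use n in simp)
      then have "real t \<le> real \<Delta>" using elim by (simp add: \<tau>_def)
      then have t\<Delta>: "t \<le> \<Delta>" by simp
      define D where "D = real (\<Delta> choose t)"
      have D: "(real \<Delta> / \<tau>) ^ t \<le> D"
        unfolding D_def \<tau>_def by (rule binomial_ge_n_over_k_pow_k[OF t\<Delta>])
      have nt: "t \<le> n" using t\<Delta> \<Delta> by simp
      have "n choose t \<le> n ^ t" by (rule binomial_le_pow[OF nt])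
      then have "real (n choose t) ^ (t - 1) \<le> (real n ^ t) ^ (t - 1)"
        by (intro power_mono) (metis of_nat_le_iff of_nat_power, simp)
      also have "\<dots> = real n powr Q"
        using n t by (simp add: Q_def \<tau>_def of_nat_diff powr_powr flip: powr_realpow power_mult)
      finally have C_upper: "real (n choose t) ^ (t - 1) \<le> real n powr Q" .
      have pow_powr: "((real \<Delta> / \<tau>) ^ t) ^ m = (real \<Delta> / \<tau>) powr (\<tau> * real m)" for m
        using \<Delta>0 \<tau> by (simp add: \<tau>_def powr_powr flip: powr_realpow power_mult)
      \<comment> \<open>The exponent of \<open>n\<close> is \<open>(1 - 1 / \<tau> + \<eta>) *
        \<tau> * \<tau> = Q + \<eta> * \<tau> * \<tau>\<close> on the right against \<open>Q\<close>
        on the left; the surplus swallows the constants.\<close>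
      have dense: "2 * real (l choose t) * real (n choose t) ^ (t - 1) < D ^ t"
      proof -
        have "2 * real (l choose t) * real (n choose t) ^ (t - 1) * \<tau> powr (\<tau> * \<tau>)
          \<le> 2 * real (l choose t) * \<tau> powr (\<tau> * \<tau>) * real n powr Q"
          using mult_left_mono[OF C_upper, of "2 * real (l choose t) * \<tau> powr (\<tau> * \<tau>)"] by (simp add: mult_ac)
        also have "\<dots> < real n powr (\<eta> * \<tau> * \<tau>) * real n powr Q"
          using elim n by (intro mult_strict_right_mono) auto
        also have "\<dots> = (real n powr (1 - 1 / \<tau> + \<eta>)) powr (\<tau> * \<tau>)"
          using \<tau> by (simp add: powr_powr Q_def algebra_simps flip: powr_add)
        also have "\<dots> \<le> real \<Delta> powr (\<tau> * \<tau>)"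
          using \<Delta>_lower \<tau> by (intro powr_mono2) auto
        also have "\<dots> = ((real \<Delta> / \<tau>) ^ t) ^ t * \<tau> powr (\<tau> * \<tau>)"
          unfolding pow_powr using \<tau> by (simp add: powr_divide \<tau>_def)
        also have "\<dots> \<le> D ^ t * \<tau> powr (\<tau> * \<tau>)"
          using D \<tau> by (intro mult_right_mono power_mono) auto
        finally show ?thesis by (rule mult_right_less_imp_less) simp
      qed
      \<comment> \<open>Few heavy rows do no harm, because they must be long:
        \<open>N powr e * \<Delta> powr Q\<close> equals
        \<open>(N * \<Delta>) powr Q * N powr (e - Q)\<close>, where \<open>e - Q \<le> 0\<close>
        allows replacing \<open>N\<close> by \<open>n\<close>. The surplus exponent is at least
        \<open>(\<tau> - 1) * (\<tau> - 1) * \<eta>\<close>.\<close>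
      have large: "real (G k) powr (real t - 1 - \<kappa>) * real (n choose t) ^ (t - 1)
         \<le> real N powr (real t - 1 - \<kappa>) * D ^ (t - 1)"
      proof -
        have "real (G k) powr e * real (n choose t) ^ (t - 1) * \<tau> powr Q
          \<le> real (G k) powr e * \<tau> powr Q * real n powr Q"
          using mult_left_mono[OF C_upper, of "real (G k) powr e * \<tau> powr Q"] by (simp add: mult_ac)
        also have "\<dots> \<le> real n powr ((\<tau> - 1) * (\<tau> - 1) * \<eta>) * real n powr Q"
          using elim by (intro mult_right_mono) auto
        also have "\<dots> = real n powr ((\<tau> - 1) * (\<tau> - 1) * \<eta> + Q)" by (simp add: powr_add)
        also have "\<dots> \<le> real n powr ((2 - 1 / \<tau> + \<eta>) * Q + (e - Q))"
        proof (intro powr_mono)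
          have "(2 - 1 / \<tau> + \<eta>) * Q = 2 * Q - (\<tau> - 1) + \<eta> * Q"
            using \<tau> by (simp add: Q_def algebra_simps)
          moreover have "(\<tau> - 1) * (\<tau> - 1) * \<eta> = \<eta> * Q - (\<tau> - 1) * \<eta>"
            by (simp add: Q_def algebra_simps)
          ultimately show "(\<tau> - 1) * (\<tau> - 1) * \<eta> + Q \<le> (2 - 1 / \<tau> + \<eta>) * Q + (e - Q)"
            using \<kappa>\<eta> by (simp add: e_def)
        qed (use elim in simp)
        also have "\<dots> = (real n powr (2 - 1 / \<tau> + \<eta>)) powr Q * real n powr (e - Q)"
          by (simp only: powr_powr powr_add[of _ "(2 - 1 / \<tau> + \<eta>) * Q"])
        also have "\<dots> \<le> (real N * real \<Delta>) powr Q * real N powr (e - Q)"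
        proof (intro mult_mono)
          show "(real n powr (2 - 1 / \<tau> + \<eta>)) powr Q \<le> (real N * real \<Delta>) powr Q"
            using N\<Delta> Q by (intro powr_mono2) auto
          have "\<tau> * 1 \<le> Q" unfolding Q_def using \<tau> by (intro mult_left_mono) auto
          then have "e - Q \<le> 0" using \<kappa> by (simp add: e_def)
          then show "real n powr (e - Q) \<le> real N powr (e - Q)"
            using N Nn by (intro powr_mono2') auto
        qed auto
        also have "\<dots> = real N powr e * real \<Delta> powr Q"
          using N \<Delta>0 by (simp add: powr_mult powr_diff)
        also have "\<dots> = real N powr e * ((real \<Delta> / \<tau>) ^ t) ^ (t - 1) * \<tau> powr Q"
          unfolding pow_powr using \<tau> t by (simp add: powr_divide \<tau>_def of_nat_diff Q_def)
        also have "\<dots> \<le> real N powr e * D ^ (t - 1) * \<tau> powr Q"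
          using D \<tau> by (intro mult_right_mono mult_left_mono power_mono) auto
        finally have "real (G k) powr e * real (n choose t) ^ (t - 1) \<le> real N powr e * D ^ (t - 1)"
          by (rule mult_right_le_imp_le) (use \<tau> in simp)
        then show ?thesis by (simp add: e_def \<tau>_def)
      qed
      define f where "f = enumerate R"
      have f: "f i \<in> R" if "i < N" for i
        using finite_enumerate_in_set[OF finR] that by (simp add: f_def N_def)
      have "\<exists>B\<subseteq>row E (f i). card B = \<Delta>" if "i < N" for i
        using obtain_subset_with_card_n[of \<Delta> "row E (f i)"] f[OF that] by (auto simp: R_def)
      then obtain A where A: "\<And>i. i < N \<Longrightarrow> A i \<subseteq> row E (f i) \<and> card (A i) = \<Delta>" by metis
      interpret rows A "{..<n}" t by unfold_locales (use t in auto)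
      have "\<exists>W\<subseteq>{..<n}. card W = l \<and> order_rich A {..<N} t k W"
      proof (rule order_rich_if_dense[where \<Delta> = \<Delta> and G = G and \<theta> = \<theta> and \<kappa> = \<kappa>])
        show "A r \<subseteq> {..<n} \<and> card (A r) = \<Delta>" if "r < N" for r
          using A[OF that] row_sub by blast
      qed (use N l \<kappa> G \<theta> dense large in \<open>auto simp: D_def \<tau>_def\<close>)
      then obtain W where W: "W \<subseteq> {..<n}" "card W = l" "order_rich A {..<N} t k W" by blast
      have "order_rich (row E) {..<n} t k W"
      proof (rule order_rich_reindex[OF W(3)])
        show "f i < f j" if "i < j" "j < N" for i j
          using that finR by (simp add: f_def N_def finite_enumerate_mono)
        show "f i \<in> {..<n} \<and> A i \<subseteq> row E (f i)" if "i < N" for i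
          using f[OF that] A[OF that] by (simp add: R_def)
      qed
      then show "\<exists>W\<subseteq>{..<n}. card W = l \<and> order_rich (row E) {..<n} t k W" using W by blast
    qed
  qed
qed

section \<open>Dense matrices: the case \<open>t = 1\<close>\<close>

text \<open>
  In the \<open>m\<close>-ary tree of intervals few columns meet \<open>k\<close> children of the same node, so the number of
  pairs of a node and a column meeting it grows essentially by at most the factor \<open>k\<close> per level.
\<close>
lemma sum_card_le_if_not_rich:
  fixes A :: "nat \<Rightarrow> 'c set"
  assumes "finite C" and "1 \<le> k" "k \<le> m" and "l \<ge> 1"
    and "\<not> (\<exists>W\<subseteq>C. card W = l \<and> order_rich A {a..<a + m ^ L} 1 k W)"
  shows "(\<Sum>r\<in>{a..<a + m ^ L}. card (A r \<inter> C)) \<le> k ^ L * card C + L * m ^ L * (l * 2 ^ m)"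
  using assms(1) assms(5)
proof (induction L arbitrary: a C)
  case 0
  then show ?case by (auto intro!: card_mono)
next
  case (Suc L)
  define I where "I u = {a + u * m ^ L..<a + u * m ^ L + m ^ L}" for u
  define C' where "C' u = {c \<in> C. \<exists>r\<in>I u. c \<in> A r}" for u
  define H where "H c = {u. u < m \<and> c \<in> C' u}" for c
  \<comment> \<open>\<open>H c\<close> is the set of children that column \<open>c\<close> meets. A
    column outside \<open>Big\<close> contributes fewer than \<open>k\<close> children, a column in
    \<open>Big\<close> at most \<open>m\<close>.\<close>
  define Big where "Big = {c \<in> C. k \<le> card (H c)}"
  have finC': "finite (C' u)" for u using Suc.prems(1) by (simp add: C'_def)
  have Isub: "I u \<subseteq> {a..<a + m ^ Suc L}" if "u < m" for u
  proof -
    have "Suc u * m ^ L \<le> m * m ^ L" using that by (intro mult_le_mono1) simp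
    then show ?thesis by (auto simp: I_def)
  qed
  have Iord: "r < r'" if "u < u'" "r \<in> I u" "r' \<in> I u'" for u u' r r'
  proof -
    have "Suc u * m ^ L \<le> u' * m ^ L" using that by (intro mult_le_mono1) simp
    then show ?thesis using that by (simp add: I_def)
  qed
  have not_rich: "\<not> order_rich A {a..<a + m ^ Suc L} 1 k W" if "W \<subseteq> C" "card W = l" for W
    using Suc.prems(2) that by blast
  have child: "(\<Sum>r\<in>I u. card (A r \<inter> C)) \<le> k ^ L * card (C' u) + L * m ^ L * (l * 2 ^ m)" if u: "u < m" for u
  proof -
    have "(\<Sum>r\<in>I u. card (A r \<inter> C)) = (\<Sum>r\<in>I u. card (A r \<inter> C' u))"
      by (intro sum.cong refl arg_cong[where f = card]) (auto simp: C'_def)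
    also have "\<dots> \<le> k ^ L * card (C' u) + L * m ^ L * (l * 2 ^ m)"
      unfolding I_def
    proof (rule Suc.IH[OF finC'])
      show "\<not> (\<exists>W\<subseteq>C' u. card W = l \<and> order_rich A {a + u * m ^ L..<a + u * m ^ L + m ^ L} 1 k W)"
      proof (intro notI, elim exE conjE)
        fix W assume W: "W \<subseteq> C' u" "card W = l" and "order_rich A {a + u * m ^ L..<a + u * m ^ L + m ^ L} 1 k W"
        then have "order_rich A {a..<a + m ^ Suc L} 1 k W"
          using order_rich_mono Isub[OF u] unfolding I_def by metis
        moreover have "W \<subseteq> C" using W by (auto simp: C'_def)
        ultimately show False using not_rich W by blast
      qed
    qed
    finally show ?thesis .
  qed
  \<comment> \<open>Pigeonhole on the at most \<open>2 ^ m\<close> patterns: \<open>l\<close>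
    columns with the same pattern \<open>h\<close> of at least \<open>k\<close> children would be
    rich, with the first \<open>k\<close> children of \<open>h\<close> as the sets
    \<open>J i\<close>.\<close>
  have "card {c \<in> Big. H c = h} \<le> l" if "h \<subseteq> {..<m}" for h
  proof (rule ccontr)
    assume "\<not> ?thesis"
    then obtain W where W: "W \<subseteq> {c \<in> Big. H c = h}" "card W = l"
      using obtain_subset_with_card_n[of l "{c \<in> Big. H c = h}"] by auto
    obtain c where c: "c \<in> W" using W \<open>l \<ge> 1\<close> by fastforce
    then have h: "k \<le> card h" using W by (auto simp: Big_def)
    have finh: "finite h" using that by (rule finite_subset) simp
    have enum: "enumerate h i \<in> h" if "i < k" for i
      using finite_enumerate_in_set[OF finh] h that by simp
    have "order_rich A {a..<a + m ^ Suc L} 1 k W"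
    proof (rule order_richI[of k "\<lambda>i. I (enumerate h i)"])
      show "I (enumerate h i) \<subseteq> {a..<a + m ^ Suc L}" if "i < k" for i
        using enum[OF that] \<open>h \<subseteq> {..<m}\<close> by (intro Isub) blast
      show "r < r'" if "i < j" "j < k" "r \<in> I (enumerate h i)" "r' \<in> I (enumerate h j)" for i j r r'
      proof (rule Iord[OF _ that(3,4)])
        show "enumerate h i < enumerate h j"
          using that h finh by (intro finite_enumerate_mono) auto
      qed
      show "\<exists>r\<in>I (enumerate h i). T \<subseteq> A r" if "i < k" "T \<subseteq> W" "card T = 1" for i T
      proof -
        obtain d where d: "T = {d}" using \<open>card T = 1\<close> by (metis card_1_singletonE)
        have "H d = h" using d \<open>T \<subseteq> W\<close> W by auto
        then have "enumerate h i \<in> H d" using enum[OF \<open>i < k\<close>] by simp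
        then show ?thesis by (auto simp: H_def C'_def d)
      qed
    qed
    then show False using not_rich[of W] W by (auto simp: Big_def)
  qed
  then have "(\<Sum>h\<in>Pow {..<m}. card {c \<in> Big. H c = h}) \<le> (\<Sum>h\<in>Pow {..<m}. l)"
    by (intro sum_mono) auto
  also have "\<dots> = l * 2 ^ m" by (simp add: card_Pow)
  also have "(\<Sum>h\<in>Pow {..<m}. card {c \<in> Big. H c = h}) = card (\<Union>h\<in>Pow {..<m}. {c \<in> Big. H c = h})"
    using Suc.prems(1) by (intro card_UN_disjoint[symmetric]) (auto simp: Big_def)
  also have "(\<Union>h\<in>Pow {..<m}. {c \<in> Big. H c = h}) = Big"
  proof -
    have "H c \<in> Pow {..<m}" for c by (auto simp: H_def)
    then show ?thesis by blast
  qed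
  finally have Big: "card Big \<le> l * 2 ^ m" .
  have "(\<Sum>u<m. card (C' u)) = (\<Sum>u<m. \<Sum>c\<in>C. of_bool (c \<in> C' u))"
    using Suc.prems(1) by (intro sum.cong refl) (auto simp: sum_of_bool_eq C'_def intro!: arg_cong[where f = card])
  also have "\<dots> = (\<Sum>c\<in>C. \<Sum>u<m. of_bool (c \<in> C' u))" by (rule sum.swap)
  also have "\<dots> = (\<Sum>c\<in>C. card (H c))"
    by (intro sum.cong refl) (auto simp: sum_of_bool_eq H_def intro!: arg_cong[where f = card])
  also have "\<dots> \<le> (\<Sum>c\<in>C. k + (if c \<in> Big then m else 0))"
  proof (intro sum_mono)
    fix c assume "c \<in> C"
    moreover have "card (H c) \<le> card {..<m}" by (intro card_mono) (auto simp: H_def)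
    ultimately show "card (H c) \<le> k + (if c \<in> Big then m else 0)" by (auto simp: Big_def)
  qed
  also have "\<dots> = k * card C + m * card Big"
    using Suc.prems(1) by (simp add: sum.distrib sum.If_cases Big_def Int_def)
  also have "\<dots> \<le> k * card C + m * (l * 2 ^ m)" using Big by simp
  finally have sumC': "(\<Sum>u<m. card (C' u)) \<le> k * card C + m * (l * 2 ^ m)" .
  have part: "{a..<a + m ^ Suc L} = (\<Union>u\<in>{..<m}. I u)"
  proof
    show "{a..<a + m ^ Suc L} \<subseteq> (\<Union>u\<in>{..<m}. I u)"
    proof
      fix r assume r: "r \<in> {a..<a + m ^ Suc L}"
      have m: "m ^ L > 0" using \<open>1 \<le> k\<close> \<open>k \<le> m\<close> by simp
      define u where "u = (r - a) div m ^ L"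
      have "r - a < m * m ^ L" using r by auto
      then have "u < m" unfolding u_def by (rule less_mult_imp_div_less)
      moreover have "u * m ^ L \<le> r - a" "r - a < m ^ L + u * m ^ L"
        using dividend_less_div_times[OF m, of "r - a"] unfolding u_def by simp_all
      then have "r \<in> I u"
        using r unfolding I_def atLeastLessThan_iff by linarith
      ultimately show "r \<in> (\<Union>u\<in>{..<m}. I u)" by blast
    qed
  qed (use Isub in blast)
  have "(\<Sum>r\<in>{a..<a + m ^ Suc L}. card (A r \<inter> C)) = (\<Sum>u<m. \<Sum>r\<in>I u. card (A r \<inter> C))"
    unfolding part
  proof (rule sum.UNION_disjoint)
    show "\<forall>u\<in>{..<m}. \<forall>u'\<in>{..<m}. u \<noteq> u' \<longrightarrow> I u \<inter> I u' = {}"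
      using Iord by (metis disjoint_iff less_irrefl linorder_neqE_nat)
  qed (auto simp: I_def)
  also have "\<dots> \<le> (\<Sum>u<m. k ^ L * card (C' u) + L * m ^ L * (l * 2 ^ m))"
    by (intro sum_mono child) auto
  also have "\<dots> = k ^ L * (\<Sum>u<m. card (C' u)) + m * (L * m ^ L * (l * 2 ^ m))"
    by (simp add: sum.distrib sum_distrib_left)
  also have "\<dots> \<le> k ^ L * (k * card C + m * (l * 2 ^ m)) + m * (L * m ^ L * (l * 2 ^ m))"
    using sumC' by (intro add_mono mult_left_mono) auto
  \<comment> \<open>In the error term \<open>k ^ L\<close> is coarsened to \<open>m ^ L\<close>, so
    that every level contributes the same amount.\<close>
  also have "k ^ L * (k * card C + m * (l * 2 ^ m)) \<le> k ^ Suc L * card C + m ^ L * (m * (l * 2 ^ m))"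
    using \<open>k \<le> m\<close> by (simp add: algebra_simps power_mono mult_le_mono)
  finally show ?case by (simp add: algebra_simps)
qed

text \<open>For \<open>t = 1\<close> the range \<open>0 < \<kappa> < t - 1\<close> of the energy
  argument is empty; the interval tree takes its place. Its main term is
  \<open>n * k ^ (L + 1)\<close> and its error is of order \<open>n * ln n\<close>.\<close>

lemma eventually_rich_columns_1:
  fixes \<epsilon> :: real
  assumes "\<epsilon> > 0" and k: "k \<ge> 1" and l: "l \<ge> 1"
  shows "\<forall>\<^sub>F n in sequentially. \<forall>E. E \<subseteq> {..<n} \<times> {..<n} \<and> real n powr (1 + \<epsilon>) \<le> real (card E) \<longrightarrow>
    (\<exists>W\<subseteq>{..<n}. card W = l \<and> order_rich (row E) {..<n} 1 k W)"
proof -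
  \<comment> \<open>The arity is so large that \<open>k \<le> m powr (\<epsilon> / 2)\<close>; then
    \<open>k ^ L \<le> n powr (\<epsilon> / 2)\<close> as soon as
    \<open>m ^ L \<le> n\<close>.\<close>
  define m where "m = Suc k + nat \<lceil>real k powr (2 / \<epsilon>)\<rceil>"
  have m: "m \<ge> 2" "k \<le> m" using k by (auto simp: m_def)
  have "real k powr (2 / \<epsilon>) \<le> real m" unfolding m_def by linarith
  then have "(real k powr (2 / \<epsilon>)) powr (\<epsilon> / 2) \<le> real m powr (\<epsilon> / 2)"
    using \<open>\<epsilon> > 0\<close> by (intro powr_mono2) auto
  then have km: "real k \<le> real m powr (\<epsilon> / 2)"
    using \<open>\<epsilon> > 0\<close> k by (simp add: powr_powr)
  define K K' where "K = real k" and "K' = real (m * (l * 2 ^ m))"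
  have K: "K > 0" "K' > 0" using k l m by (auto simp: K_def K'_def)
  have "\<forall>\<^sub>F n in sequentially. K * real n powr (\<epsilon> / 2) * real n + (1 + 2 * ln (real n)) * real n * K' < real n powr (1 + \<epsilon>)"
    using K \<open>\<epsilon> > 0\<close> by real_asymp
  moreover have "\<forall>\<^sub>F n :: nat in sequentially. n \<ge> 1" by (rule eventually_ge_at_top)
  ultimately show ?thesis
  proof eventually_elim
    case (elim n)
    show ?case
    proof (intro allI impI, rule ccontr)
      fix E assume E: "E \<subseteq> {..<n} \<times> {..<n} \<and> real n powr (1 + \<epsilon>) \<le> real (card E)"
      assume poor: "\<not> (\<exists>W\<subseteq>{..<n}. card W = l \<and> order_rich (row E) {..<n} 1 k W)"
      \<comment> \<open>The tree has depth \<open>L + 1\<close> and may extend beyond row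
        \<open>n\<close>. The additional rows are empty, hence useless for richness, and the
        overshoot costs only constant factors.\<close>
      obtain L where L: "m ^ L \<le> n" "n < m ^ (L + 1)"
        using ex_power_ivl1[OF m(1)] elim by blast
      have empty: "row E r = {}" if "r \<ge> n" for r using E that by (auto simp: row_def)
      have "\<not> (\<exists>W\<subseteq>{..<n}. card W = l \<and> order_rich (row E) {0..<0 + m ^ (L + 1)} 1 k W)"
      proof (intro notI, elim exE conjE)
        fix W assume W: "W \<subseteq> {..<n}" "card W = l" and rich: "order_rich (row E) {0..<0 + m ^ (L + 1)} 1 k W"
        obtain J where J: "\<forall>i<k. J i \<subseteq> {0..<0 + m ^ (L + 1)}"
    "\<forall>i j. i < j \<longrightarrow> j < k \<longrightarrow> (\<forall>r\<in>J i. \<forall>r'\<in>J j. r < r')"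
    "\<forall>i<k. \<forall>T\<subseteq>W. card T = 1 \<longrightarrow> (\<exists>r\<in>J i. T \<subseteq> row E r)"
    using rich by (rule order_richE)
  note J = J[rule_format]
        have "order_rich (row E) {..<n} 1 k W"
        proof (rule order_richI[of k "\<lambda>i. J i \<inter> {..<n}"])
          show "r < r'" if "i < j" "j < k" "r \<in> J i \<inter> {..<n}" "r' \<in> J j \<inter> {..<n}" for i j r r'
            using J(2)[of i j r r'] that by blast
          show "\<exists>r\<in>J i \<inter> {..<n}. T \<subseteq> row E r" if "i < k" "T \<subseteq> W" "card T = 1" for i T
          proof -
            have "\<exists>r\<in>J i. T \<subseteq> row E r" using that by (rule J(3))
            then obtain r where r: "r \<in> J i" "T \<subseteq> row E r" by blast
            obtain c where "T = {c}" using \<open>card T = 1\<close> by (rule card_1_singletonE)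
            then have "row E r \<noteq> {}" using r(2) by blast
            then have "r < n" using empty[of r] by (meson not_less)
            then show ?thesis using r by blast
          qed
        qed auto
        then show False using poor W by blast
      qed
      then have "(\<Sum>r\<in>{0..<0 + m ^ (L + 1)}. card (row E r \<inter> {..<n}))
        \<le> k ^ (L + 1) * card {..<n} + (L + 1) * m ^ (L + 1) * (l * 2 ^ m)"
        by (intro sum_card_le_if_not_rich) (use k m l in auto)
      moreover have "card E = (\<Sum>r\<in>{0..<0 + m ^ (L + 1)}. card (row E r \<inter> {..<n}))"
      proof -
        have "E = Sigma {0..<0 + m ^ (L + 1)} (\<lambda>r. row E r \<inter> {..<n})"
          using E L by (auto simp: row_def)
        then show ?thesis by (rule trans[OF arg_cong[where f = card]]) (intro card_SigmaI, auto)
      qed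
      ultimately have "card E \<le> k ^ (L + 1) * n + (L + 1) * m ^ (L + 1) * (l * 2 ^ m)" by simp
      then have "real (card E) \<le> real (k ^ (L + 1) * n + (L + 1) * m ^ (L + 1) * (l * 2 ^ m))"
        by (simp only: of_nat_le_iff)
      also have "\<dots> = real k * real k ^ L * real n + real (L + 1) * real (m ^ L) * K'"
        by (simp add: K'_def algebra_simps)
      also have "\<dots> \<le> K * real n powr (\<epsilon> / 2) * real n + (1 + 2 * ln (real n)) * real n * K'"
      proof (intro add_mono mult_right_mono mult_mono)
        have "real k ^ L \<le> (real m powr (\<epsilon> / 2)) ^ L" using km by (intro power_mono) auto
        also have "\<dots> = real (m ^ L) powr (\<epsilon> / 2)"
          using m by (simp add: powr_powr mult.commute flip: powr_realpow)
        also have "\<dots> \<le> real n powr (\<epsilon> / 2)"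
          using L \<open>\<epsilon> > 0\<close> by (intro powr_mono2 of_nat_mono) auto
        finally show "real k ^ L \<le> real n powr (\<epsilon> / 2)" .
        have "2 ^ L \<le> m ^ L" using m by (intro power_mono) auto
        then have "real (2 ^ L) \<le> real n" using L by (intro of_nat_mono) linarith
        then have "ln (2 ^ L) \<le> ln (real n)" by (intro ln_mono) auto
        then have "real L * ln 2 \<le> ln (real n)" by (simp add: ln_realpow)
        \<comment> \<open>This gives \<open>ln 2 \<ge> 1 / 2\<close>, whence
          \<open>L \<le> 2 * ln n\<close> from \<open>2 ^ L \<le> n\<close>.\<close>
        moreover have "ln (1 / 2 :: real) \<le> 1 / 2 - 1" by (rule ln_le_minus_one) simp
        then have "real L * (1 / 2) \<le> real L * ln 2"
          by (intro mult_left_mono) (simp_all add: ln_div)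
        ultimately show "real (L + 1) \<le> 1 + 2 * ln (real n)" by simp
        then show "0 \<le> 1 + 2 * ln (real n)" by linarith
      qed (use L K in \<open>auto simp: K_def\<close>)
      also have "\<dots> < real n powr (1 + \<epsilon>)" using elim by simp
      finally show False using E by simp
    qed
  qed
qed

lemma eventually_rich_columns:
  fixes \<epsilon> :: real
  assumes "t \<ge> 1" "t \<le> l" "k \<ge> 1" "\<epsilon> > 0"
  shows "\<forall>\<^sub>F n in sequentially. \<forall>E. E \<subseteq> {..<n} \<times> {..<n} \<and> real n powr (2 - 1 / real t + \<epsilon>) \<le> real (card E) \<longrightarrow>
    (\<exists>W\<subseteq>{..<n}. card W = l \<and> order_rich (row E) {..<n} t k W)"
proof (cases "t = 1")
  case True
  then show ?thesis using eventually_rich_columns_1[of \<epsilon> k l] assms by simp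
next
  case False
  then show ?thesis using eventually_rich_columns_ge2 assms by simp
qed

section \<open>Ordered graphs\<close>

lemma rank_less:
  assumes "finite S" "trans R" "irrefl R" "(u, v) \<in> R" "u \<in> S"
  shows "card {w \<in> S. (w, u) \<in> R} < card {w \<in> S. (w, v) \<in> R}"
proof (rule psubset_card_mono)
  show "{w \<in> S. (w, u) \<in> R} \<subset> {w \<in> S. (w, v) \<in> R}"
    using assms by (auto simp: irrefl_def dest: transD)
qed (use assms in simp)

lemma rank_less_card:
  assumes "finite S" "irrefl R" "v \<in> S"
  shows "card {w \<in> S. (w, v) \<in> R} < card S"
  using assms by (intro psubset_card_mono) (auto simp: irrefl_def)

lemma ordered_graphD:
  assumes "ordered_graph G"
  shows "finite (verts G)" "finite (edges G)" "e \<in> edges G \<Longrightarrow> e \<subseteq> verts G"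
    "e \<in> edges G \<Longrightarrow> card e = 2" "ord G \<subseteq> verts G \<times> verts G"
    "trans (ord G)" "irrefl (ord G)" "total_on (verts G) (ord G)"
proof -
  show fin: "finite (verts G)" using assms by (simp add: ordered_graph_def)
  have "edges G \<subseteq> Pow (verts G)" using assms by (auto simp: ordered_graph_def)
  then show "finite (edges G)" using fin finite_subset by blast
qed (use assms in \<open>auto simp: ordered_graph_def strict_linear_order_on_def\<close>)

text \<open>Vertices are numbered by their number of predecessors. Only entries above the diagonal
  are kept, so every one of the matrix carries order information: its row precedes its
  column.\<close>

lemma ordered_graph_matrix:
  fixes G :: "'b ograph"
  assumes G: "ordered_graph G" and n: "card (verts G) = n"
  obtains g :: "nat \<Rightarrow> 'b" and E where "E \<subseteq> {..<n} \<times> {..<n}" "card (edges G) \<le> card E"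
    "\<And>i. i < n \<Longrightarrow> g i \<in> verts G" "\<And>i j. i < j \<Longrightarrow> j < n \<Longrightarrow> (g i, g j) \<in> ord G"
    "\<And>i j. (i, j) \<in> E \<Longrightarrow> i < j \<and> {g i, g j} \<in> edges G"
proof -
  note Gd = ordered_graphD[OF G]
  define h where "h v = card {u \<in> verts G. (u, v) \<in> ord G}" for v
  have less: "h u < h v" if "(u, v) \<in> ord G" for u v
    unfolding h_def using Gd that by (intro rank_less) auto
  have inj: "inj_on h (verts G)"
  proof (rule inj_onI, rule ccontr)
    fix u v assume uv: "u \<in> verts G" "v \<in> verts G" "h u = h v" "u \<noteq> v"
    then have "(u, v) \<in> ord G \<or> (v, u) \<in> ord G" using Gd(8) by (auto simp: total_on_def)
    then show False using less uv(3) by fastforce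
  qed
  have "h ` verts G \<subseteq> {..<n}"
    using rank_less_card[OF Gd(1,7)] by (auto simp: h_def n)
  then have img: "h ` verts G = {..<n}"
    using inj n by (intro card_subset_eq) (auto simp: card_image)
  define g where "g = the_inv_into (verts G) h"
  have gh: "g (h v) = v" if "v \<in> verts G" for v
    using inj that by (simp add: g_def the_inv_into_f_f)
  have g: "g i \<in> verts G" "h (g i) = i" if "i < n" for i
    using that img the_inv_into_into[OF inj, of i "verts G"] f_the_inv_into_f[OF inj, of i] by (auto simp: g_def)
  define E where "E = {(i, j). i < j \<and> j < n \<and> {g i, g j} \<in> edges G}"
  show thesis
  proof (rule that[of E g])
    show E: "E \<subseteq> {..<n} \<times> {..<n}" by (auto simp: E_def)
    then have "finite E" using finite_subset by blast
    have "edges G \<subseteq> (\<lambda>(i, j). {g i, g j}) ` E"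
    proof
      fix e assume e: "e \<in> edges G"
      obtain u v where uv: "e = {u, v}" "u \<noteq> v" using Gd(4)[OF e] unfolding card_2_iff by blast
      then have V: "u \<in> verts G" "v \<in> verts G" using Gd(3)[OF e] by auto
      then have lt: "h u < n" "h v < n" using img by auto
      have "h u \<noteq> h v" using inj V uv by (auto simp: inj_on_def)
      then have "(h u, h v) \<in> E \<or> (h v, h u) \<in> E"
        using e lt V uv by (auto simp: E_def gh insert_commute)
      then show "e \<in> (\<lambda>(i, j). {g i, g j}) ` E"
        using gh V uv by (force simp: insert_commute)
    qed
    then show "card (edges G) \<le> card E"
      using \<open>finite E\<close> by (meson card_image_le card_mono finite_imageI le_trans)
    show "(g i, g j) \<in> ord G" if "i < j" "j < n" for i j
    proof (rule ccontr)
      assume "(g i, g j) \<notin> ord G"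
      moreover have "g i \<noteq> g j" using g(2)[of i] g(2)[of j] that by auto
      moreover have "g i \<in> verts G" "g j \<in> verts G" using g(1) that by auto
      ultimately have "(g j, g i) \<in> ord G" using Gd(8) by (auto simp: total_on_def)
      then show False using less[of "g j" "g i"] g(2) that by simp
    qed
  qed (auto simp: E_def g)
qed

text \<open>A vertex \<open>x\<close> of \<open>X\<close> becomes a row of \<open>J (rx x)\<close>
  with ones in the columns of all its neighbours, which are at most \<open>t\<close>; a vertex
  \<open>y\<close> of \<open>Y\<close> becomes the column of \<open>W\<close> given by its rank.
  Order within \<open>X\<close> comes from the order of the sets \<open>J i\<close>, order within
  \<open>Y\<close> from the enumeration of \<open>W\<close>.\<close>

lemma eventually_contains_ordered:
  fixes H :: "'a ograph" and \<epsilon> :: real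
  assumes t: "t \<ge> 1" and H: "ordered_graph H" and XY: "ordered_bipartition H X Y"
    and deg: "\<forall>v\<in>X. degree H v \<le> t" and "\<epsilon> > 0"
  shows "\<forall>\<^sub>F n in sequentially. \<forall>G :: 'b ograph. ordered_graph G \<and> card (verts G) = n \<and>
    real n powr (2 - 1 / real t + \<epsilon>) \<le> real (card (edges G)) \<longrightarrow> contains_ordered G H"
proof -
  note Hd = ordered_graphD[OF H]
  have V: "verts H = X \<union> Y" "X \<inter> Y = {}" and XYord: "\<And>x y. x \<in> X \<Longrightarrow> y \<in> Y \<Longrightarrow> (x, y) \<in> ord H"
    and indep: "\<And>e. e \<in> edges H \<Longrightarrow> \<not> e \<subseteq> X \<and> \<not> e \<subseteq> Y"
    using XY by (auto simp: ordered_bipartition_def)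
  have fin: "finite X" "finite Y" using Hd(1) V by auto
  define k where "k = card X"
  define l where "l = card Y + t"
  \<comment> \<open>The ones of the host matrix lie above the diagonal. So an additional last row \<open>q\<close> with a one in an
    additional first column \<open>w 0\<close> forces the rows for \<open>X\<close> to precede the columns for \<open>Y\<close>; the
    remaining spare columns are there to pad neighbourhoods to size exactly \<open>t\<close>.\<close>
  have rich: "\<forall>\<^sub>F n in sequentially. \<forall>E. E \<subseteq> {..<n} \<times> {..<n} \<and> real n powr (2 - 1 / real t + \<epsilon>) \<le> real (card E) \<longrightarrow>
    (\<exists>W\<subseteq>{..<n}. card W = Suc l \<and> order_rich (row E) {..<n} t (Suc k) W)"
    by (rule eventually_rich_columns) (use t \<open>\<epsilon> > 0\<close> in \<open>auto simp: l_def\<close>)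
  show ?thesis
    using rich
  proof eventually_elim
    case (elim n)
    show ?case
    proof (intro allI impI, elim conjE)
      fix G :: "'b ograph" assume G: "ordered_graph G" and n: "card (verts G) = n"
        and dense: "real n powr (2 - 1 / real t + \<epsilon>) \<le> real (card (edges G))"
      obtain g E where E: "E \<subseteq> {..<n} \<times> {..<n}" "card (edges G) \<le> card E"
        and g: "\<And>i. i < n \<Longrightarrow> g i \<in> verts G" "\<And>i j. i < j \<Longrightarrow> j < n \<Longrightarrow> (g i, g j) \<in> ord G"
        and gE: "\<And>i j. (i, j) \<in> E \<Longrightarrow> i < j \<and> {g i, g j} \<in> edges G"
        using ordered_graph_matrix[OF G n] by metis
      have "real n powr (2 - 1 / real t + \<epsilon>) \<le> real (card E)" using dense E(2) by linarith
      then obtain W where W: "W \<subseteq> {..<n}" "card W = Suc l" and "order_rich (row E) {..<n} t (Suc k) W"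
        using elim E(1) by blast
      then obtain J where J: "\<forall>i<Suc k. J i \<subseteq> {..<n}"
        "\<forall>i j. i < j \<longrightarrow> j < Suc k \<longrightarrow> (\<forall>r\<in>J i. \<forall>r'\<in>J j. r < r')"
        "\<forall>i<Suc k. \<forall>T\<subseteq>W. card T = t \<longrightarrow> (\<exists>r\<in>J i. T \<subseteq> row E r)"
        by (elim order_richE)
      note J = J[rule_format]
      have finW: "finite W" using W(2) card.infinite by fastforce
      have hit: "\<exists>r\<in>J i. S \<subseteq> row E r" if "i < Suc k" "S \<subseteq> W" "card S \<le> t" for i S
      proof -
        have "\<exists>T. S \<subseteq> T \<and> T \<subseteq> W \<and> card T = t"
          using that finW W(2) by (intro exists_subset_between) (auto simp: l_def)
        then obtain T where "S \<subseteq> T" "T \<subseteq> W" "card T = t" by blast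
        then show ?thesis using J(3)[of i T] that by blast
      qed
      define w where "w = enumerate W"
      have w: "w i \<in> W" if "i < Suc l" for i
        using finite_enumerate_in_set[OF finW] that W by (simp add: w_def)
      have w_less: "w i < w j" if "i < j" "j < Suc l" for i j
        using finite_enumerate_mono[OF _ finW] that W by (simp add: w_def)
      define rx where "rx x = card {u \<in> X. (u, x) \<in> ord H}" for x
      define ry where "ry y = card {u \<in> Y. (u, y) \<in> ord H}" for y
      have rx: "rx x < k" if "x \<in> X" for x
        unfolding rx_def k_def using fin Hd(7) that by (intro rank_less_card) auto
      have ry: "Suc (ry y) < Suc l" if "y \<in> Y" for y
        using rank_less_card[OF fin(2) Hd(7) that] by (simp add: ry_def l_def)
      \<comment> \<open>Ranks are shifted by one because \<open>w 0\<close> is reserved for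
        separating rows from columns.\<close>
      define c where "c y = w (Suc (ry y))" for y
      have cW: "c y \<in> W" if "y \<in> Y" for y using ry[OF that] by (simp add: c_def w)
      define nb where "nb x = {y. {x, y} \<in> edges H}" for x
      have nbY: "nb x \<subseteq> Y" if "x \<in> X" for x
      proof
        fix y assume "y \<in> nb x"
        then have e: "{x, y} \<in> edges H" by (simp add: nb_def)
        then show "y \<in> Y" using indep[OF e] Hd(3)[OF e] that V by auto
      qed
      have "card (nb x) \<le> t" if x: "x \<in> X" for x
      proof -
        have "inj_on (\<lambda>y. {x, y}) (nb x)" by (auto simp: inj_on_def doubleton_eq_iff)
        then have "card (nb x) \<le> card {e \<in> edges H. x \<in> e}"
          using Hd(2) by (intro card_inj_on_le) (auto simp: nb_def)
        then show ?thesis using deg x by (force simp: degree_def)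
      qed
      then have "\<exists>r\<in>J (rx x). c ` nb x \<subseteq> row E r" if "x \<in> X" for x
        using rx[OF that] cW nbY[OF that] that fin(2)
        by (intro hit) (auto intro: order_trans[OF card_image_le] finite_subset)
      then obtain r where r: "\<And>x. x \<in> X \<Longrightarrow> r x \<in> J (rx x)" "\<And>x. x \<in> X \<Longrightarrow> c ` nb x \<subseteq> row E (r x)"
        by metis
      have "\<exists>q\<in>J k. {w 0} \<subseteq> row E q" using w t by (intro hit) auto
      then obtain q where q: "q \<in> J k" "(q, w 0) \<in> E" by (auto simp: row_def)
      define f where "f v = (if v \<in> X then r v else c v)" for v
      have f_lt: "f v < n" if "v \<in> verts H" for v
      proof (cases "v \<in> X")
        case True
        then have "r v \<in> {..<n}" using J(1)[of "rx v"] r(1) rx[of v] by auto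
        then show ?thesis using True by (simp add: f_def)
      next
        case False
        then have "c v \<in> W" using that V by (intro cW) auto
        then show ?thesis using W(1) False by (auto simp: f_def)
      qed
      have f_less: "f u < f v" if uv: "(u, v) \<in> ord H" for u v
      proof -
        have vert: "u \<in> X \<union> Y" "v \<in> X \<union> Y" using uv Hd(5) V by auto
        have "\<not> (u \<in> Y \<and> v \<in> X)"
          using XYord[of v u] uv transD[OF Hd(6), of u v u] Hd(7) by (auto simp: irrefl_def)
        then consider "u \<in> X" "v \<in> X" | "u \<in> X" "v \<in> Y" | "u \<in> Y" "v \<in> Y" using vert by blast
        then show ?thesis
        proof cases
          case 1
          then have "rx u < rx v" unfolding rx_def using fin Hd uv by (intro rank_less) auto
          then show ?thesis using J(2)[of "rx u" "rx v" "r u" "r v"] rx[of v] r(1) 1 by (simp add: f_def)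
        next
          case 2
          then have "r u < q" using J(2)[of "rx u" k "r u" q] rx[of u] r(1) q by simp
          moreover have "q < w 0" using gE q by blast
          moreover have "w 0 < c v" unfolding c_def using ry[OF 2(2)] by (intro w_less) auto
          ultimately show ?thesis using 2 V by (auto simp: f_def)
        next
          case 3
          then have "ry u < ry v" unfolding ry_def using fin Hd uv by (intro rank_less) auto
          then have "c u < c v" unfolding c_def using ry[OF 3(2)] by (intro w_less) auto
          then show ?thesis using 3 V by (auto simp: f_def)
        qed
      qed
      have f_edge: "(g \<circ> f) ` e \<in> edges G" if e: "e \<in> edges H" for e
      proof -
        obtain u v where uv: "e = {u, v}" using Hd(4)[OF e] unfolding card_2_iff by blast
        then obtain x y where xy: "e = {x, y}" "x \<in> X" "y \<in> Y"
          using indep[OF e] Hd(3)[OF e] V by (auto simp: insert_commute)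
        then have "y \<in> nb x" using e by (simp add: nb_def)
        then have "(r x, c y) \<in> E" using r(2)[OF xy(2)] by (auto simp: row_def)
        then show ?thesis using gE xy V by (auto simp: f_def)
      qed
      have gf_ord: "((g \<circ> f) u, (g \<circ> f) v) \<in> ord G" if "(u, v) \<in> ord H" for u v
      proof -
        have "v \<in> verts H" using that Hd(5) by blast
        then show ?thesis using g(2)[OF f_less[OF that] f_lt] by simp
      qed
      \<comment> \<open>Distinct vertices are comparable, so preservation of a strict order already
        yields injectivity.\<close>
      have f_inj: "inj_on (g \<circ> f) (verts H)"
      proof (rule inj_onI, rule ccontr)
        fix u v assume uv: "u \<in> verts H" "v \<in> verts H" "(g \<circ> f) u = (g \<circ> f) v" "u \<noteq> v"
        then have "(u, v) \<in> ord H \<or> (v, u) \<in> ord H" using Hd(8) by (auto simp: total_on_def)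
        then have "((g \<circ> f) u, (g \<circ> f) v) \<in> ord G \<or> ((g \<circ> f) v, (g \<circ> f) u) \<in> ord G"
          using gf_ord by blast
        then show False using uv(3) ordered_graphD(7)[OF G] by (auto simp: irrefl_def)
      qed
      show "contains_ordered G H"
        unfolding contains_ordered_def
      proof (intro exI[of _ "g \<circ> f"] conjI f_inj ballI f_edge)
        show "(g \<circ> f) ` verts H \<subseteq> verts G" using f_lt g(1) by auto
        show "case p of (x, y) \<Rightarrow> ((g \<circ> f) x, (g \<circ> f) y) \<in> ord G" if "p \<in> ord H" for p
          using that gf_ord by (cases p) auto
      qed
    qed
  qed
qed

section \<open>Order reversal and the extremal number\<close>

text \<open>Reversal exchanges the two sides of an ordered bipartition and so reduces bounded degree
  in \<open>Y\<close> to bounded degree in \<open>X\<close>.\<close>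

definition reverse :: "'a ograph \<Rightarrow> 'a ograph" where
  "reverse G = G\<lparr>ord := (ord G)\<inverse>\<rparr>"

lemma reverse_simps [simp]:
  "verts (reverse G) = verts G" "edges (reverse G) = edges G" "ord (reverse G) = (ord G)\<inverse>"
  by (simp_all add: reverse_def)

lemma ordered_graph_reverse: "ordered_graph G \<Longrightarrow> ordered_graph (reverse G)"
  by (auto simp: ordered_graph_def strict_linear_order_on_def)

lemma contains_ordered_reverse:
  "contains_ordered (reverse G) (reverse H) \<Longrightarrow> contains_ordered G H"
  unfolding contains_ordered_def by (elim ex_forward) auto

text \<open>Without edges one colour would do. An edge is needed so that the maximum defining
  \<open>ex_ord\<close> ranges over a nonempty set.\<close>

lemma edges_nonempty_if_ordered_bipartite:
  assumes "ordered_bipartite H"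
  shows "edges H \<noteq> {}"
proof
  assume "edges H = {}"
  then have "interval_colouring H 1 (\<lambda>_. 0)"
    by (auto simp: interval_colouring_def order_interval_def)
  then have "interval_chromatic_number H \<le> 1"
    unfolding interval_chromatic_number_def by (intro Least_le) blast
  then show False using assms by (simp add: ordered_bipartite_def)
qed

lemma ex_ord_less:
  assumes "edges H \<noteq> {}"
    and "\<And>G :: nat ograph. ordered_graph G \<Longrightarrow> card (verts G) = n \<Longrightarrow> \<not> contains_ordered G H \<Longrightarrow>
      real (card (edges G)) < b"
  shows "real (ex_ord n H) < b"
proof -
  let ?S = "{card (edges G) | G :: nat ograph. ordered_graph G \<and> card (verts G) = n \<and> \<not> contains_ordered G H}"
  \<comment> \<open>The edgeless host avoids \<open>H\<close> and shows that the set of edge numbers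
    is nonempty, so its \<open>Max\<close> is attained.\<close>
  define G where "G = \<lparr>verts = {..<n}, edges = {}, ord = {(i, j). i < j \<and> j < n}\<rparr>"
  have "ordered_graph G"
    by (auto simp: G_def ordered_graph_def strict_linear_order_on_def trans_def irrefl_def total_on_def)
  moreover have "\<not> contains_ordered G H"
    using assms(1) by (auto simp: G_def contains_ordered_def)
  ultimately have "card (edges G) \<in> ?S" by (auto simp: G_def intro!: exI[of _ G])
  then have "Max ?S \<in> ?S" using finite_ex_ord_set by (intro Max_in) auto
  then show ?thesis using assms(2) unfolding ex_ord_def by auto
qed

theorem theorem1p7:
  fixes t :: nat and H :: "'a ograph" and X Y :: "'a set"
  assumes "t \<ge> 1"
    and "ordered_bipartite H"
    and "ordered_bipartition H X Y"
    and "(\<forall>v\<in>X. degree H v \<le> t) \<or> (\<forall>v\<in>Y. degree H v \<le> t)"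
  shows "\<forall>\<epsilon>::real. \<epsilon> > 0 \<longrightarrow>
           (\<exists>n\<^sub>0. \<forall>n\<ge>n\<^sub>0. real (ex_ord n H) \<le> real n powr (2 - 1 / real t + \<epsilon>))"
proof (intro allI impI)
  fix \<epsilon> :: real assume "\<epsilon> > 0"
  have H: "ordered_graph H" using assms(2) by (simp add: ordered_bipartite_def)
  have "\<forall>\<^sub>F n in sequentially. \<forall>G :: nat ograph. ordered_graph G \<and> card (verts G) = n \<and>
    real n powr (2 - 1 / real t + \<epsilon>) \<le> real (card (edges G)) \<longrightarrow> contains_ordered G H"
    using assms(4)
  proof
    assume "\<forall>v\<in>X. degree H v \<le> t"
    then show ?thesis by (rule eventually_contains_ordered[OF assms(1) H assms(3) _ \<open>\<epsilon> > 0\<close>])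
  next
    assume "\<forall>v\<in>Y. degree H v \<le> t"
    then have "\<forall>v\<in>Y. degree (reverse H) v \<le> t" by (simp add: degree_def)
    moreover have "ordered_bipartition (reverse H) Y X"
      using assms(3) by (auto simp: ordered_bipartition_def)
    ultimately have "\<forall>\<^sub>F n in sequentially. \<forall>G :: nat ograph. ordered_graph G \<and> card (verts G) = n \<and>
      real n powr (2 - 1 / real t + \<epsilon>) \<le> real (card (edges G)) \<longrightarrow> contains_ordered G (reverse H)"
      using eventually_contains_ordered[OF assms(1) ordered_graph_reverse[OF H] _ _ \<open>\<epsilon> > 0\<close>] by blast
    then show ?thesis
    proof eventually_elim
      case (elim n)
      show ?case
      proof (intro allI impI)
        fix G :: "nat ograph"
        assume "ordered_graph G \<and> card (verts G) = n \<and> real n powr (2 - 1 / real t + \<epsilon>) \<le> real (card (edges G))"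
        then have "contains_ordered (reverse G) (reverse H)"
          using elim by (simp add: ordered_graph_reverse)
        then show "contains_ordered G H" by (rule contains_ordered_reverse)
      qed
    qed
  qed
  then have "\<forall>\<^sub>F n in sequentially. real (ex_ord n H) \<le> real n powr (2 - 1 / real t + \<epsilon>)"
  proof eventually_elim
    case (elim n)
    have "real (ex_ord n H) < real n powr (2 - 1 / real t + \<epsilon>)"
      using edges_nonempty_if_ordered_bipartite[OF assms(2)] elim
      by (intro ex_ord_less) (auto simp: not_le[symmetric])
    then show ?case by simp
  qed
  then show "\<exists>n\<^sub>0. \<forall>n\<ge>n\<^sub>0. real (ex_ord n H) \<le> real n powr (2 - 1 / real t + \<epsilon>)"
    by (simp add: eventually_sequentially)
qed

end
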